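(* Let $N\in\mathbb N$, $p\ge0$, and let $h:\mathbb N\to\mathbb R$ satisfy $h(x)=O(x^p)$ as $x\to\infty$. Let $X_1,\dots,X_n$ be a family of independent $\mathbb N$-valued random variables with means $\lambda_i>0$ and up to $(N+p+1)$-th order moments; let $W=X_1+\cdots+X_n$. Let $X_i^*$ be an $\mathbb N$-valued random variable having the Poisson $X_i$-zero biased distribution and independent of $W^{(i)}:=W-X_i$. Let $e_N(h)$ be the remainder defined recursively in the context, and let $f_h$ be the Stein solution with parameter $\lambda_W=\mathbb E[W]$. Then the following estimations hold. 1) When $N=0$, $$|e_0(h)|\le \max(2^{p-1},1)\,\|f_h\|_{0,p}\sum_{i=1}^n\Big(\mathbb E[(W^{(i)})^p]\big(\mathbb E[X_i^2]+\lambda_i^2-\lambda_i\big)+\lambda_i\big(\mathbb E[(X_i^* )^{p+1}]+\mathbb E[X_i^{p+1}]\big)\Big).$$ 2) When $N\ge1$, one has the recursive estimation $$\begin{aligned}|e_N(h)|\le\sum_{i=1}^n\lambda_i\bigg[&\sum_{d\ge1}\ \sum_{\mathbf J\in\mathbb N_*^d,\ |\mathbf J|\le N}m_{X_i}^{(\mathbf J^\circ)}\big(m_{X_i^*}^{(\mathbf J^\dagger)}+m_{X_i}^{(\mathbf J^\dagger)}\big)\big|e_{N-|\mathbf J|}(\Delta^{|\mathbf J|}f_h(\cdot+1))\big|\\ &+\max(2^{p-1},1)\,\|f_h\|_{N,p}\sum_{k=0}^N m_{X_i^*}^{(k)}\sum_{d\ge0}\ \sum_{\mathbf J\in\mathbb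 N_*^d,\ |\mathbf J|\le N-k}m_{X_i}^{(\mathbf J)}\big(\mathbb E[(W^{(i)})^p]\,m_{X_i}^{(N-k-|\mathbf J|+1)}+m_{X_i}^{(N-k-|\mathbf J|+1),p}\big)\\ &+\max(2^{p-1},1)\,\|f_h\|_{N,p}\big(\mathbb E[(W^{(i)})^p]\,m_{X_i^*}^{(N+1)}+m_{X_i^*}^{(N+1),p}\big)\bigg].\end{aligned}$$
   Context: $\mathbb N=\{0,1,2,\dots\}$, $\mathbb N_*=\mathbb N\setminus\{0\}$. $\mathcal P_\lambda(g)$ is the expectation of $g$ under the Poisson distribution with parameter $\lambda$. Stein solution: for $g:\mathbb N\to\mathbb R$ of polynomial growth, with $\lambda=\lambda_W=\lambda_1+\cdots+\lambda_n$ and $x\in\mathbb N_*$, $$f_g(x)=\frac{(x-1)!}{\lambda^x}\sum_{i=x}^\infty\frac{\lambda^i}{i!}\big(g(i)-\mathcal P_\lambda(g)\big);$$ $f_g(0)$ is arbitrary and not used. $f_g(\cdot+1)$ denotes the function $x\mapsto f_g(x+1)$ on $\mathbb N$. Zero bias: for an $\mathbb N$-valued random variable $X$ with mean $\lambda>0$, an $\mathbb N$-valued random variable $X^*$ has the Poisson $X$-zero biased distribution if $\mathbb E[Xf(X)]=\lambda\,\mathbb E[f(X^*+1)]$ for every $f:\mathbb N\to\mathbb R$ such that the left side is well defined; this distribution is unique, with $\mathbb P(X^*=x)=(x+1)\mathbb P(X=x+1)/\lambda$ for $x\in\mathbb N$. $\Delta f(x)=f(x+1)-f(x)$, and $\Delta^k$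 is its $k$-th iterate. For $g$ with $g(x)=O(x^p)$ and $N\in\mathbb N$, $$\|g\|_{N,p}:=\sup_{x\in\mathbb N_*}\frac{|\Delta^{N+1}g(x)|}{x^p}.$$ Moments: for an $\mathbb N$-valued random variable $Y$, $m_Y^{(k)}:=\mathbb E\big[\binom Yk\big]$ and $m_Y^{(k),p}:=\mathbb E\big[\binom Yk Y^p\big]$. Multi-indices: for $d\ge1$ and $\mathbf J=(j_1,\dots,j_d)\in\mathbb N_*^d$, $|\mathbf J|=j_1+\cdots+j_d$, $m_Y^{(\mathbf J)}=m_Y^{(j_1)}\cdots m_Y^{(j_d)}$, $\mathbf J^\dagger=j_d$, $\mathbf J^\circ=(j_1,\dots,j_{d-1})\in\mathbb N_*^{d-1}$. By convention $\mathbb N_*^0=\{\emptyset\}$, $|\emptyset|=0$, $m_Y^{(\emptyset)}=1$. For independent $\mathbb N$-valued random variables $X,Y$ and $M\in\mathbb N$, $$\delta_M(f,X,Y)=\mathbb E\Big[\sum_{0\le j_1<\cdots<j_{M+1}<Y}\Delta^{M+1}f(X+j_1)\Big],$$ $$\varepsilon_M(f,X,Y)=-\sum_{d\ge0}(-1)^d\sum_{\mathbf J\in\mathbb N_*^d,\ |\mathbf J|\le M}m_Y^{(\mathbf J)}\,\delta_{M-|\mathbf J|}(\Delta^{|\mathbf J|}f,X,Y).$$ The remainder $e_N(h)$: $e_0(h)=\mathbb E[h(W)]-\mathcal P_{\lambda_W}(h)$ and, recursively for $N\ge1$, $$\begin{aligned}e_N(h)=\sum_{i=1}^n\lambda_i\Big[&\sum_{d\ge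 1}(-1)^{d-1}\sum_{\mathbf J\in\mathbb N_*^d,\ |\mathbf J|\le N} m_{X_i}^{(\mathbf J^\circ)}\big(m_{X_i^*}^{(\mathbf J^\dagger)}-m_{X_i}^{(\mathbf J^\dagger)}\big)\,e_{N-|\mathbf J|}\big(\Delta^{|\mathbf J|}f_h(\cdot+1)\big)\\&+\sum_{k=0}^N m_{X_i^*}^{(k)}\,\varepsilon_{N-k}\big(\Delta^k f_h(\cdot+1),W^{(i)},X_i\big)+\delta_N\big(f_h(\cdot+1),W^{(i)},X_i^*\big)\Big].\end{aligned}$$ *)

theory Defs
  imports "HOL-Probability.Probability" "HOL-Library.Landau_Symbols"
begin

text \<open>
  Throughout, \<open>M\<close> is a probability space, random variables with values in the natural numbers are
  functions \<open>'a \<Rightarrow> nat\<close>, and the families \<open>X\<close> and \<open>Xs\<close> (for the zero biased variables) are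
  indexed by \<open>{1..n}\<close>.
\<close>

definition fdiff :: "(nat \<Rightarrow> real) \<Rightarrow> nat \<Rightarrow> real" where
  "fdiff f x = f (x + 1) - f x"

text \<open>The power of a natural number with a real exponent, with \<open>0\<^sup>0 = 1\<close>; \<open>powr\<close> has \<open>0 powr 0 = 0\<close>.\<close>

definition npow :: "nat \<Rightarrow> real \<Rightarrow> real" where
  "npow x p = (if p = 0 then 1 else real x powr p)"

definition poisson_exp :: "real \<Rightarrow> (nat \<Rightarrow> real) \<Rightarrow> real" where
  "poisson_exp l g = measure_pmf.expectation (poisson_pmf l) g"

text \<open>The value at \<open>0\<close> is irrelevant: only \<open>stein_sol l g (x + 1)\<close> is ever used.\<close>

definition stein_sol :: "real \<Rightarrow> (nat \<Rightarrow> real) \<Rightarrow> nat \<Rightarrow> real" where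
  "stein_sol l g x =
     fact (x - 1) / l ^ x * (\<Sum>\<^sub>\<infinity>i\<in>{x..}. l ^ i / fact i * (g i - poisson_exp l g))"

text \<open>The supremum is taken in the extended nonnegative reals, so that it always exists.\<close>

definition diff_norm :: "nat \<Rightarrow> real \<Rightarrow> (nat \<Rightarrow> real) \<Rightarrow> ennreal" where
  "diff_norm N p g = (SUP x\<in>{1..}. ennreal (\<bar>(fdiff ^^ (N + 1)) g x\<bar> / npow x p))"

definition mean :: "'a measure \<Rightarrow> ('a \<Rightarrow> nat) \<Rightarrow> real" where
  "mean M Y = (\<integral>\<omega>. real (Y \<omega>) \<partial>M)"

definition poisson_zero_biased :: "'a measure \<Rightarrow> ('a \<Rightarrow> nat) \<Rightarrow> ('a \<Rightarrow> nat) \<Rightarrow> bool" where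
  "poisson_zero_biased M Y Ys \<longleftrightarrow>
     (\<forall>f :: nat \<Rightarrow> real. integrable M (\<lambda>\<omega>. real (Y \<omega>) * f (Y \<omega>)) \<longrightarrow>
        integrable M (\<lambda>\<omega>. f (Ys \<omega> + 1)) \<and>
        (\<integral>\<omega>. real (Y \<omega>) * f (Y \<omega>) \<partial>M) = mean M Y * (\<integral>\<omega>. f (Ys \<omega> + 1) \<partial>M))"

text \<open>
  Real-valued moments, used for the remainder, where only finite moments occur.
\<close>

definition mom :: "'a measure \<Rightarrow> ('a \<Rightarrow> nat) \<Rightarrow> nat \<Rightarrow> real" where
  "mom M Y k = (\<integral>\<omega>. real (Y \<omega> choose k) \<partial>M)"

definition mom_idx :: "'a measure \<Rightarrow> ('a \<Rightarrow> nat) \<Rightarrow> nat list \<Rightarrow> real" where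
  "mom_idx M Y J = (\<Prod>j\<leftarrow>J. mom M Y j)"

text \<open>
  The same moments as elements of \<open>[0, \<infinity>]\<close>, used for the upper bounds, since the zero
  biased variables may have infinite moments of the highest order occurring there.  (The Bochner
  integral of a non-integrable function is \<open>0\<close>.)
\<close>

definition pmom_nn :: "'a measure \<Rightarrow> ('a \<Rightarrow> nat) \<Rightarrow> real \<Rightarrow> ennreal" where
  "pmom_nn M Y p = (\<integral>\<^sup>+\<omega>. ennreal (npow (Y \<omega>) p) \<partial>M)"

definition mom_nn :: "'a measure \<Rightarrow> ('a \<Rightarrow> nat) \<Rightarrow> nat \<Rightarrow> ennreal" where
  "mom_nn M Y k = (\<integral>\<^sup>+\<omega>. ennreal (real (Y \<omega> choose k)) \<partial>M)"

definition mom_pow_nn :: "'a measure \<Rightarrow> ('a \<Rightarrow> nat) \<Rightarrow> nat \<Rightarrow> real \<Rightarrow> ennreal" where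
  "mom_pow_nn M Y k p = (\<integral>\<^sup>+\<omega>. ennreal (real (Y \<omega> choose k) * npow (Y \<omega>) p) \<partial>M)"

definition mom_idx_nn :: "'a measure \<Rightarrow> ('a \<Rightarrow> nat) \<Rightarrow> nat list \<Rightarrow> ennreal" where
  "mom_idx_nn M Y J = (\<Prod>j\<leftarrow>J. mom_nn M Y j)"

text \<open>
  Multi-indices of length \<open>d\<close> with positive entries and total degree at most \<open>m\<close>, as lists:
  \<open>sum_list\<close>, \<open>last\<close> and \<open>butlast\<close> give the degree, the last entry and the multi-index without its
  last entry.  There are none when \<open>d > m\<close>, so sums over all \<open>d\<close> are written as sums up to \<open>m\<close>.
\<close>

definition multi_idx :: "nat \<Rightarrow> nat \<Rightarrow> nat list set" where
  "multi_idx d m = {J. length J = d \<and> (\<forall>j\<in>set J. 0 < j) \<and> sum_list J \<le> m}"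

text \<open>The tuples \<open>j\<^sub>1 < \<dots> < j\<^bsub>m+1\<^esub>\<close> are encoded as sets \<open>S\<close>, so that \<open>j\<^sub>1 = Min S\<close>.\<close>

definition delta :: "'a measure \<Rightarrow> nat \<Rightarrow> (nat \<Rightarrow> real) \<Rightarrow> ('a \<Rightarrow> nat) \<Rightarrow> ('a \<Rightarrow> nat) \<Rightarrow> real" where
  "delta M m f Y Z =
     (\<integral>\<omega>. (\<Sum>S | S \<subseteq> {..<Z \<omega>} \<and> card S = m + 1. (fdiff ^^ (m + 1)) f (Y \<omega> + Min S)) \<partial>M)"

definition eps :: "'a measure \<Rightarrow> nat \<Rightarrow> (nat \<Rightarrow> real) \<Rightarrow> ('a \<Rightarrow> nat) \<Rightarrow> ('a \<Rightarrow> nat) \<Rightarrow> real" where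
  "eps M m f Y Z =
     - (\<Sum>d=0..m. (- 1) ^ d *
          (\<Sum>J\<in>multi_idx d m. mom_idx M Z J *
             delta M (m - sum_list J) ((fdiff ^^ sum_list J) f) Y Z))"

definition total :: "nat \<Rightarrow> (nat \<Rightarrow> 'a \<Rightarrow> nat) \<Rightarrow> 'a \<Rightarrow> nat" where
  "total n X \<omega> = (\<Sum>i=1..n. X i \<omega>)"

text \<open>The subtraction on \<open>nat\<close> is not truncated when \<open>i \<in> {1..n}\<close>.\<close>

definition total_without :: "nat \<Rightarrow> (nat \<Rightarrow> 'a \<Rightarrow> nat) \<Rightarrow> nat \<Rightarrow> 'a \<Rightarrow> nat" where
  "total_without n X i \<omega> = total n X \<omega> - X i \<omega>"

definition total_mean :: "'a measure \<Rightarrow> nat \<Rightarrow> (nat \<Rightarrow> 'a \<Rightarrow> nat) \<Rightarrow> real" where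
  "total_mean M n X = (\<Sum>i=1..n. mean M (X i))"

text \<open>The function \<open>f\<^sub>h(\<cdot> + 1)\<close> with parameter \<open>\<lambda>\<^sub>W\<close>.\<close>

definition stein_shift :: "'a measure \<Rightarrow> nat \<Rightarrow> (nat \<Rightarrow> 'a \<Rightarrow> nat) \<Rightarrow> (nat \<Rightarrow> real) \<Rightarrow> nat \<Rightarrow> real" where
  "stein_shift M n X h x = stein_sol (total_mean M n X) h (x + 1)"

function stein_rem ::
  "'a measure \<Rightarrow> nat \<Rightarrow> (nat \<Rightarrow> 'a \<Rightarrow> nat) \<Rightarrow> (nat \<Rightarrow> 'a \<Rightarrow> nat) \<Rightarrow> nat \<Rightarrow> (nat \<Rightarrow> real) \<Rightarrow> real" where
  "stein_rem M n X Xs 0 h = (\<integral>\<omega>. h (total n X \<omega>) \<partial>M) - poisson_exp (total_mean M n X) h"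
| "stein_rem M n X Xs (Suc N) h =
     (\<Sum>i=1..n. mean M (X i) *
       ((\<Sum>d=1..Suc N. (- 1) ^ (d - 1) *
          (\<Sum>J\<in>multi_idx d (Suc N).
             mom_idx M (X i) (butlast J) * (mom M (Xs i) (last J) - mom M (X i) (last J)) *
             stein_rem M n X Xs (Suc N - sum_list J)
               ((fdiff ^^ sum_list J) (stein_shift M n X h))))
        + (\<Sum>k=0..Suc N. mom M (Xs i) k *
             eps M (Suc N - k) ((fdiff ^^ k) (stein_shift M n X h)) (total_without n X i) (X i))
        + delta M (Suc N) (stein_shift M n X h) (total_without n X i) (Xs i)))"
  by pat_completeness auto
termination
proof (relation "Wellfounded.measure (\<lambda>(_, _, _, _, N, _). N)", goal_cases)
  case 1
  show ?case by simp
next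
  case (2 M n X Xs N h i d J)
  then show ?case
    by (cases J) (auto simp: multi_idx_def)
qed

end

theory Submission
  imports Defs "HOL-Real_Asymp.Real_Asymp"
begin

text \<open>
  Iterated differences of order \<open>m + 1\<close> at \<open>Y + Min S + 1 \<le> Y + Z\<close> are controlled by
  \<open>npow (Y + Z) p \<le> max (2 powr (p - 1)) 1 * (npow Y p + npow Z p)\<close>, and independence factors the
  expectation; there are \<open>Z choose (m + 1)\<close> sets \<open>S\<close>.  This bounds every \<open>delta\<close>, and the recursive
  estimate is the triangle inequality in \<open>[0, \<infinity>]\<close>.  For \<open>N = 0\<close>, the Stein equation
  \<open>h x - P h = x f x - \<lambda> f (x + 1)\<close> and zero biasing one summand at a time, conditionally on the
  others, write the remainder as a sum of differences of two such \<open>delta\<close> terms.  The interchange needs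
  \<open>f x = O(x\<^sup>p)\<close>, since only moments of order \<open>p + 1\<close> are available.
\<close>

section \<open>Powers and differences\<close>

lemma npow_nonneg [simp]: "0 \<le> npow x p"
  by (simp add: npow_def)

lemma npow_mono: "x \<le> y \<Longrightarrow> 0 \<le> p \<Longrightarrow> npow x p \<le> npow y p"
  by (simp add: npow_def powr_mono2)

lemma npow_pos: "0 < x \<Longrightarrow> 0 < npow x p"
  by (simp add: npow_def)

lemma npow_Suc_exponent: "0 \<le> p \<Longrightarrow> npow x (p + 1) = real x * npow x p"
  by (auto simp: npow_def powr_add)

text \<open>Convexity of \<open>t powr p\<close> at the midpoint of a and b; multiplication by
  \<open>2 powr p\<close> then leaves the constant \<open>2 powr (p - 1)\<close>.\<close>

lemma powr_add_le_convex:
  fixes a b p :: real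
  assumes "1 \<le> p" "0 < a" "0 < b"
  shows "(a + b) powr p \<le> 2 powr (p - 1) * (a powr p + b powr p)"
proof -
  have "((1 - 1/2) *\<^sub>R a + (1/2) *\<^sub>R b) powr p \<le> (1 - 1/2) * (a powr p) + (1/2) * (b powr p)"
    by (rule convex_onD[OF powr_convex[OF assms(1)]]) (use assms in auto)
  then have "((a + b) / 2) powr p \<le> (a powr p + b powr p) / 2"
    by (simp add: field_simps)
  then have "2 powr p * ((a + b) / 2) powr p \<le> 2 powr p * ((a powr p + b powr p) / 2)"
    by (intro mult_left_mono) auto
  moreover have "2 powr p * ((a + b) / 2) powr p = (a + b) powr p"
    using assms by (simp add: powr_divide)
  ultimately show ?thesis
    by (simp add: powr_diff)
qed

text \<open>After division by \<open>a + b\<close> the two ratios lie in [0, 1] and add up to 1, and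
  on this interval t \<le> \<open>t powr p\<close> because p \<le> 1.\<close>

lemma powr_add_le_concave:
  fixes a b p :: real
  assumes "0 \<le> p" "p \<le> 1" "0 < a" "0 < b"
  shows "(a + b) powr p \<le> a powr p + b powr p"
proof -
  have "x \<le> x powr p" if "0 \<le> x" "x \<le> 1" for x :: real
    using powr_mono'[of p 1 x] assms that by simp
  from this[of "a / (a + b)"] this[of "b / (a + b)"]
  have "a / (a + b) + b / (a + b) \<le> (a / (a + b)) powr p + (b / (a + b)) powr p"
    using assms by (intro add_mono) auto
  also have "a / (a + b) + b / (a + b) = 1"
    using assms by (simp add: add_divide_distrib[symmetric])
  also have "(a / (a + b)) powr p + (b / (a + b)) powr p = (a powr p + b powr p) / (a + b) powr p"
    using assms by (simp add: powr_divide add_divide_distrib)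
  finally show ?thesis
    using assms by (simp add: field_simps)
qed

lemma npow_add_le:
  assumes "0 \<le> p"
  shows "npow (a + b) p \<le> max (2 powr (p - 1)) 1 * (npow a p + npow b p)"
proof (cases "a = 0 \<or> b = 0")
  \<comment> \<open>A zero argument is treated apart, since the two preceding inequalities ask for
    positive ones. Here one term on the right already equals the left side, whichever value
    \<open>npow 0 p\<close> takes.\<close>
  case True
  have "npow (a + b) p \<le> 1 * (npow a p + npow b p)"
    using True by (auto simp: npow_def)
  also have "\<dots> \<le> max (2 powr (p - 1)) 1 * (npow a p + npow b p)"
    by (intro mult_right_mono) auto
  finally show ?thesis .
next
  case False
  show ?thesis
  proof (cases "1 \<le> p")
    case True
    then have "npow (a + b) p \<le> 2 powr (p - 1) * (npow a p + npow b p)"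
      using False powr_add_le_convex[of p "real a" "real b"] by (simp add: npow_def)
    also have "\<dots> \<le> max (2 powr (p - 1)) 1 * (npow a p + npow b p)"
      by (intro mult_right_mono) auto
    finally show ?thesis .
  next
    case p: False
    then have "npow (a + b) p \<le> 1 * (npow a p + npow b p)"
      using False powr_add_le_concave[of p "real a" "real b"] assms by (simp add: npow_def)
    also have "\<dots> \<le> max (2 powr (p - 1)) 1 * (npow a p + npow b p)"
      by (intro mult_right_mono) auto
    finally show ?thesis .
  qed
qed

lemma fdiff_funpow_shift: "(fdiff ^^ k) (\<lambda>x. g (x + 1)) x = (fdiff ^^ k) g (x + 1)"
  by (induction k arbitrary: x) (auto simp: fdiff_def)

text \<open>The supremum in \<open>diff_norm\<close> runs over x \<ge> 1, where
  \<open>npow x p\<close> is positive and the quotient can be multiplied back. The inequality lives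
  in [0, \<infinity>], so the norm may be infinite.\<close>

lemma fdiff_funpow_le_diff_norm:
  assumes "1 \<le> x"
  shows "ennreal \<bar>(fdiff ^^ (N + 1)) g x\<bar> \<le> diff_norm N p g * ennreal (npow x p)"
proof -
  have "npow x p > 0"
    using assms by (intro npow_pos) auto
  then have "ennreal \<bar>(fdiff ^^ (N + 1)) g x\<bar>
      = ennreal (\<bar>(fdiff ^^ (N + 1)) g x\<bar> / npow x p) * ennreal (npow x p)"
    by (subst ennreal_mult[symmetric]) auto
  also have "\<dots> \<le> diff_norm N p g * ennreal (npow x p)"
    unfolding diff_norm_def by (intro mult_right_mono SUP_upper) (use assms in auto)
  finally show ?thesis .
qed

section \<open>The recursive estimate\<close>

lemma ennreal_abs_sum_le: "ennreal \<bar>\<Sum>x\<in>A. f x\<bar> \<le> (\<Sum>x\<in>A. ennreal \<bar>f x\<bar>)"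
  by (subst sum_ennreal) (auto intro!: ennreal_leI sum_abs)

lemma ennreal_abs_add_le: "ennreal \<bar>x + y\<bar> \<le> ennreal \<bar>x\<bar> + ennreal \<bar>y\<bar>"
  by (simp flip: ennreal_plus add: ennreal_leI abs_triangle_ineq)

lemma ennreal_abs_add3_le: "ennreal \<bar>x + y + z\<bar> \<le> ennreal \<bar>x\<bar> + ennreal \<bar>y\<bar> + ennreal \<bar>z\<bar>"
  by (intro order_trans[OF ennreal_abs_add_le] add_mono ennreal_abs_add_le order_refl)

lemma ennreal_abs_diff_le: "ennreal \<bar>x - y\<bar> \<le> ennreal \<bar>x\<bar> + ennreal \<bar>y\<bar>"
  by (simp flip: ennreal_plus add: ennreal_leI abs_triangle_ineq4)

lemma ennreal_abs_mult: "ennreal \<bar>x * y\<bar> = ennreal \<bar>x\<bar> * ennreal \<bar>y\<bar>"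
  by (simp add: abs_mult ennreal_mult)

text \<open>A non-integrable function has Bochner integral 0, so the bound holds for every f. This
  spares all integrability arguments in the recursive estimate.\<close>

lemma ennreal_abs_integral_le:
  fixes f :: "'a \<Rightarrow> real"
  shows "ennreal \<bar>\<integral>x. f x \<partial>M\<bar> \<le> (\<integral>\<^sup>+x. ennreal \<bar>f x\<bar> \<partial>M)"
proof (cases "integrable M f")
  case True
  then show ?thesis
    using integral_norm_bound_ennreal[of M f] by simp
qed (simp add: not_integrable_integral_eq)

lemma mom_le_mom_nn: "ennreal \<bar>mom M Y k\<bar> \<le> mom_nn M Y k"
  unfolding mom_def mom_nn_def
  by (rule order_trans[OF ennreal_abs_integral_le]) simp

lemma mom_idx_le_mom_idx_nn: "ennreal \<bar>mom_idx M Y J\<bar> \<le> mom_idx_nn M Y J"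
proof (induction J)
  case Nil
  then show ?case by (simp add: mom_idx_def mom_idx_nn_def)
next
  case (Cons j J)
  have "ennreal \<bar>mom_idx M Y (j # J)\<bar> = ennreal \<bar>mom M Y j\<bar> * ennreal \<bar>mom_idx M Y J\<bar>"
    by (simp add: mom_idx_def ennreal_abs_mult)
  also have "\<dots> \<le> mom_nn M Y j * mom_idx_nn M Y J"
    by (intro mult_mono mom_le_mom_nn Cons) auto
  finally show ?case
    by (simp add: mom_idx_nn_def)
qed

text \<open>Independence turns the joint law into the product of the two laws, and Tonelli splits
  the integral. Nonnegativity replaces integrability, so infinite moments are allowed.\<close>

lemma (in prob_space) nn_integral_indep_var_mult:
  fixes f :: "'b \<Rightarrow> ennreal" and g :: "'b \<Rightarrow> ennreal"
  assumes "indep_var S Y T Z" and f [measurable]: "f \<in> borel_measurable S"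
    and g [measurable]: "g \<in> borel_measurable T"
  shows "(\<integral>\<^sup>+\<omega>. f (Y \<omega>) * g (Z \<omega>) \<partial>M) = (\<integral>\<^sup>+\<omega>. f (Y \<omega>) \<partial>M) * (\<integral>\<^sup>+\<omega>. g (Z \<omega>) \<partial>M)"
proof -
  have [measurable]: "random_variable S Y" "random_variable T Z"
    and joint: "distr M S Y \<Otimes>\<^sub>M distr M T Z = distr M (S \<Otimes>\<^sub>M T) (\<lambda>\<omega>. (Y \<omega>, Z \<omega>))"
    using assms(1) by (auto simp: indep_var_distribution_eq)
  interpret Z: prob_space "distr M T Z" by (rule prob_space_distr) measurable
  have "(\<integral>\<^sup>+\<omega>. f (Y \<omega>) * g (Z \<omega>) \<partial>M)
      = (\<integral>\<^sup>+q. f (fst q) * g (snd q) \<partial>distr M (S \<Otimes>\<^sub>M T) (\<lambda>\<omega>. (Y \<omega>, Z \<omega>)))"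
    by (subst nn_integral_distr) auto
  also have "\<dots> = (\<integral>\<^sup>+y. \<integral>\<^sup>+z. f y * g z \<partial>distr M T Z \<partial>distr M S Y)"
    unfolding joint[symmetric] by (subst Z.nn_integral_fst[symmetric]) auto
  also have "\<dots> = (\<integral>\<^sup>+y. f y * (\<integral>\<^sup>+z. g z \<partial>distr M T Z) \<partial>distr M S Y)"
    by (subst nn_integral_cmult) auto
  also have "\<dots> = (\<integral>\<^sup>+\<omega>. f (Y \<omega>) \<partial>M) * (\<integral>\<^sup>+\<omega>. g (Z \<omega>) \<partial>M)"
    by (subst nn_integral_multc) (auto simp: nn_integral_distr)
  finally show ?thesis .
qed

text \<open>This estimates the integrand of \<open>delta\<close> for fixed values y and z of the two
  variables. The two terms stay apart because only the mixed one has to be factored by independence.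
  The hypothesis on f carries \<open>x + 1\<close> because f will be built from the Stein solution
  shifted by one.\<close>

lemma abs_sum_fdiff_subsets_le:
  assumes "0 \<le> p"
    and f: "\<And>x. ennreal \<bar>(fdiff ^^ (m + 1)) f x\<bar> \<le> D * ennreal (npow (x + 1) p)"
  shows "ennreal \<bar>\<Sum>S | S \<subseteq> {..<z} \<and> card S = m + 1. (fdiff ^^ (m + 1)) f (y + Min S)\<bar>
      \<le> ennreal (max (2 powr (p - 1)) 1) * D *
          (ennreal (npow y p) * ennreal (real (z choose (m + 1)))
            + ennreal (real (z choose (m + 1)) * npow z p))"
proof -
  let ?c = "max (2 powr (p - 1)) 1"
  have summand: "ennreal \<bar>(fdiff ^^ (m + 1)) f (y + Min S)\<bar> \<le> D * ennreal (?c * (npow y p + npow z p))"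
    if "S \<subseteq> {..<z}" "card S = m + 1" for S
  proof -
    have "finite S" "S \<noteq> {}"
      using that finite_subset by fastforce+
    then have "Min S < z"
      using that(1) Min_in by blast
    \<comment> \<open>\<open>Min S < z\<close> leaves room for the extra 1: the point
      \<open>y + Min S + 1\<close> is at most \<open>y + z\<close>.\<close>
    then have "npow (y + Min S + 1) p \<le> ?c * (npow y p + npow z p)"
      using npow_mono[of "y + Min S + 1" "y + z" p] npow_add_le[of p y z] assms(1) by linarith
    then show ?thesis
      by (intro order_trans[OF f] mult_left_mono ennreal_leI) auto
  qed
  have "ennreal \<bar>\<Sum>S | S \<subseteq> {..<z} \<and> card S = m + 1. (fdiff ^^ (m + 1)) f (y + Min S)\<bar>
      \<le> (\<Sum>S | S \<subseteq> {..<z} \<and> card S = m + 1. D * ennreal (?c * (npow y p + npow z p)))"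
    by (intro order_trans[OF ennreal_abs_sum_le] sum_mono summand) auto
  also have "\<dots> = ennreal (real (z choose (m + 1))) * (D * ennreal (?c * (npow y p + npow z p)))"
    by (simp add: n_subsets ennreal_of_nat_eq_real_of_nat del: binomial_Suc_Suc)
  also have "\<dots> = ennreal ?c * D * (ennreal (npow y p) * ennreal (real (z choose (m + 1)))
            + ennreal (real (z choose (m + 1)) * npow z p))"
    by (simp add: ennreal_mult ennreal_plus algebra_simps del: binomial_Suc_Suc)
  finally show ?thesis .
qed

lemma (in prob_space) delta_le:
  assumes "0 \<le> p"
    and indep: "indep_var (count_space UNIV) Y (count_space UNIV) Z"
    and f: "\<And>x. ennreal \<bar>(fdiff ^^ (m + 1)) f x\<bar> \<le> D * ennreal (npow (x + 1) p)"
  shows "ennreal \<bar>delta M m f Y Z\<bar>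
      \<le> ennreal (max (2 powr (p - 1)) 1) * D *
          (pmom_nn M Y p * mom_nn M Z (m + 1) + mom_pow_nn M Z (m + 1) p)"
proof -
  have [measurable]: "Y \<in> M \<rightarrow>\<^sub>M count_space UNIV" "Z \<in> M \<rightarrow>\<^sub>M count_space UNIV"
    using indep by (auto simp: indep_var_distribution_eq)
  have "ennreal \<bar>delta M m f Y Z\<bar> \<le> (\<integral>\<^sup>+\<omega>. ennreal (max (2 powr (p - 1)) 1) * D *
          (ennreal (npow (Y \<omega>) p) * ennreal (real (Z \<omega> choose (m + 1)))
            + ennreal (real (Z \<omega> choose (m + 1)) * npow (Z \<omega>) p)) \<partial>M)"
    unfolding delta_def
    by (intro order_trans[OF ennreal_abs_integral_le] nn_integral_mono abs_sum_fdiff_subsets_le assms(1) f)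
  also have "\<dots> = ennreal (max (2 powr (p - 1)) 1) * D *
      ((\<integral>\<^sup>+\<omega>. ennreal (npow (Y \<omega>) p) * ennreal (real (Z \<omega> choose (m + 1))) \<partial>M)
        + (\<integral>\<^sup>+\<omega>. ennreal (real (Z \<omega> choose (m + 1)) * npow (Z \<omega>) p) \<partial>M))"
    by (subst nn_integral_cmult, measurable, subst nn_integral_add, measurable)
  also have "(\<integral>\<^sup>+\<omega>. ennreal (npow (Y \<omega>) p) * ennreal (real (Z \<omega> choose (m + 1))) \<partial>M)
      = pmom_nn M Y p * mom_nn M Z (m + 1)"
    unfolding pmom_nn_def mom_nn_def
    by (rule nn_integral_indep_var_mult[OF indep]) auto
  finally show ?thesis
    by (simp add: mom_pow_nn_def)
qed

text \<open>The r differences already applied and the m + 1 inside \<open>delta\<close> combine to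
  order m + r + 1, which is what \<open>diff_norm (m + r)\<close> measures. The shift by one moves
  every evaluation point into the range x \<ge> 1 of the supremum.\<close>

lemma (in prob_space) delta_stein_shift_le:
  assumes "0 \<le> p"
    and "indep_var (count_space UNIV) Y (count_space UNIV) Z"
  shows "ennreal \<bar>delta M m ((fdiff ^^ r) (stein_shift M' n X h)) Y Z\<bar>
      \<le> ennreal (max (2 powr (p - 1)) 1) * diff_norm (m + r) p (stein_sol (total_mean M' n X) h) *
          (pmom_nn M Y p * mom_nn M Z (m + 1) + mom_pow_nn M Z (m + 1) p)"
proof (rule delta_le[OF assms])
  fix x
  have "(fdiff ^^ (m + 1)) ((fdiff ^^ r) (stein_shift M' n X h)) x
      = (fdiff ^^ (m + r + 1)) (\<lambda>x. stein_sol (total_mean M' n X) h (x + 1)) x"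
    by (simp add: funpow_add stein_shift_def[abs_def])
  also have "\<dots> = (fdiff ^^ (m + r + 1)) (stein_sol (total_mean M' n X) h) (x + 1)"
    by (rule fdiff_funpow_shift)
  finally show "ennreal \<bar>(fdiff ^^ (m + 1)) ((fdiff ^^ r) (stein_shift M' n X h)) x\<bar>
      \<le> diff_norm (m + r) p (stein_sol (total_mean M' n X) h) * ennreal (npow (x + 1) p)"
    using fdiff_funpow_le_diff_norm[of "x + 1"] by simp
qed

lemma (in prob_space) eps_stein_shift_le:
  assumes "0 \<le> p"
    and indep: "indep_var (count_space UNIV) Y (count_space UNIV) Z"
  shows "ennreal \<bar>eps M m ((fdiff ^^ k) (stein_shift M' n X h)) Y Z\<bar>
      \<le> ennreal (max (2 powr (p - 1)) 1) * diff_norm (m + k) p (stein_sol (total_mean M' n X) h) *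
          (\<Sum>d=0..m. \<Sum>J\<in>multi_idx d m. mom_idx_nn M Z J *
             (pmom_nn M Y p * mom_nn M Z (m - sum_list J + 1) + mom_pow_nn M Z (m - sum_list J + 1) p))"
    (is "_ \<le> ?C * _")
proof -
  let ?f = "stein_shift M' n X h"
  have "ennreal \<bar>eps M m ((fdiff ^^ k) ?f) Y Z\<bar>
      \<le> (\<Sum>d=0..m. \<Sum>J\<in>multi_idx d m. ennreal \<bar>mom_idx M Z J\<bar> *
            ennreal \<bar>delta M (m - sum_list J) ((fdiff ^^ sum_list J) ((fdiff ^^ k) ?f)) Y Z\<bar>)"
    unfolding eps_def abs_minus_cancel
    by (intro order_trans[OF ennreal_abs_sum_le] sum_mono)
       (auto simp: ennreal_abs_mult[symmetric] abs_mult power_abs intro!: order_trans[OF ennreal_abs_sum_le])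
  also have "\<dots> \<le> (\<Sum>d=0..m. \<Sum>J\<in>multi_idx d m. mom_idx_nn M Z J * (?C *
             (pmom_nn M Y p * mom_nn M Z (m - sum_list J + 1) + mom_pow_nn M Z (m - sum_list J + 1) p)))"
  proof (intro sum_mono mult_mono mom_idx_le_mom_idx_nn)
    fix d J assume "J \<in> multi_idx d m"
    \<comment> \<open>A multi-index has degree at most m, so the subtraction is exact. Hence
      \<open>delta\<close> of index m - |J| after |J| + k differences always carries the norm of
      index m + k, and the single constant \<open>?C\<close> serves all summands.\<close>
    then have "m - sum_list J + (sum_list J + k) = m + k"
      by (simp add: multi_idx_def)
    then show "ennreal \<bar>delta M (m - sum_list J) ((fdiff ^^ sum_list J) ((fdiff ^^ k) ?f)) Y Z\<bar>
      \<le> ?C * (pmom_nn M Y p * mom_nn M Z (m - sum_list J + 1) + mom_pow_nn M Z (m - sum_list J + 1) p)"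
      using delta_stein_shift_le[OF assms, of "m - sum_list J" "sum_list J + k"]
      by (simp add: funpow_add)
  qed auto
  also have "\<dots> = ?C * (\<Sum>d=0..m. \<Sum>J\<in>multi_idx d m. mom_idx_nn M Z J *
             (pmom_nn M Y p * mom_nn M Z (m - sum_list J + 1) + mom_pow_nn M Z (m - sum_list J + 1) p))"
    by (simp add: sum_distrib_left mult.left_commute)
  finally show ?thesis .
qed

text \<open>Disjoint blocks of an independent family are independent; the sum over the indices other
  than i and the evaluation at i are functions of two such blocks.\<close>

lemma (in prob_space) indep_var_total_without:
  assumes "indep_vars (\<lambda>_. count_space UNIV) X {1..n}" "i \<in> {1..n}"
  shows "indep_var (count_space UNIV) (total_without n X i) (count_space UNIV) (X i)"
proof -
  have "indep_var (count_space UNIV) ((\<lambda>x. \<Sum>j\<in>{1..n} - {i}. x j) \<circ> (\<lambda>\<omega>. restrict (\<lambda>j. X j \<omega>) ({1..n} - {i})))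
     (count_space UNIV) ((\<lambda>x. x i) \<circ> (\<lambda>\<omega>. restrict (\<lambda>j. X j \<omega>) {i}))"
    by (intro indep_var_compose[OF indep_var_restrict[OF assms(1)]]) (use assms(2) in auto)
  also have "(\<lambda>x. \<Sum>j\<in>{1..n} - {i}. x j) \<circ> (\<lambda>\<omega>. restrict (\<lambda>j. X j \<omega>) ({1..n} - {i})) = total_without n X i"
  proof
    fix \<omega>
    have "(\<Sum>j=1..n. X j \<omega>) = X i \<omega> + (\<Sum>j\<in>{1..n} - {i}. X j \<omega>)"
      by (rule sum.remove) (use assms(2) in auto)
    then show "((\<lambda>x. \<Sum>j\<in>{1..n} - {i}. x j) \<circ> (\<lambda>\<omega>. restrict (\<lambda>j. X j \<omega>) ({1..n} - {i}))) \<omega>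
        = total_without n X i \<omega>"
      by (simp add: total_without_def total_def)
  qed
  also have "(\<lambda>x. x i) \<circ> (\<lambda>\<omega>. restrict (\<lambda>j. X j \<omega>) {i}) = X i"
    by auto
  finally show ?thesis .
qed

lemma (in prob_space) stein_rem_recursive_le:
  assumes "0 \<le> p" "1 \<le> N"
    and X: "\<And>i. i \<in> {1..n} \<Longrightarrow>
      indep_var (count_space UNIV) (total_without n X i) (count_space UNIV) (X i)"
    and Xs: "\<And>i. i \<in> {1..n} \<Longrightarrow>
      indep_var (count_space UNIV) (total_without n X i) (count_space UNIV) (Xs i)"
    and C: "C = ennreal (max (2 powr (p - 1)) 1) * diff_norm N p (stein_sol (total_mean M n X) h)"
  shows "ennreal \<bar>stein_rem M n X Xs N h\<bar> \<le>
    (\<Sum>i=1..n. ennreal (mean M (X i)) *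
      ((\<Sum>d=1..N. \<Sum>J\<in>multi_idx d N.
          mom_idx_nn M (X i) (butlast J) *
          (mom_nn M (Xs i) (last J) + mom_nn M (X i) (last J)) *
          ennreal \<bar>stein_rem M n X Xs (N - sum_list J)
            ((fdiff ^^ sum_list J) (stein_shift M n X h))\<bar>)
       + C * (\<Sum>k=0..N. mom_nn M (Xs i) k *
           (\<Sum>d=0..N - k. \<Sum>J\<in>multi_idx d (N - k).
              mom_idx_nn M (X i) J *
              (pmom_nn M (total_without n X i) p * mom_nn M (X i) (N - k - sum_list J + 1)
               + mom_pow_nn M (X i) (N - k - sum_list J + 1) p)))
       + C * (pmom_nn M (total_without n X i) p * mom_nn M (Xs i) (N + 1)
              + mom_pow_nn M (Xs i) (N + 1) p)))"
proof -
  obtain N' where N: "N = Suc N'"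
    using assms(2) by (cases N) auto
  let ?f = "stein_shift M n X h" and ?W = "total_without n X"
  let ?R = "\<lambda>J. stein_rem M n X Xs (N - sum_list J) ((fdiff ^^ sum_list J) ?f)"
  \<comment> \<open>The three groups of the recursion: remainders of lower order, \<open>eps\<close>
    terms, and the final \<open>delta\<close> term. Each is bounded separately.\<close>
  define A where "A i = (\<Sum>d=1..N. (- 1) ^ (d - 1) * (\<Sum>J\<in>multi_idx d N.
    mom_idx M (X i) (butlast J) * (mom M (Xs i) (last J) - mom M (X i) (last J)) * ?R J))" for i
  define B where "B i = (\<Sum>k=0..N. mom M (Xs i) k * eps M (N - k) ((fdiff ^^ k) ?f) (?W i) (X i))" for i
  define D where "D i = delta M N ?f (?W i) (Xs i)" for i
  have A: "ennreal \<bar>A i\<bar> \<le> (\<Sum>d=1..N. \<Sum>J\<in>multi_idx d N. mom_idx_nn M (X i) (butlast J) *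
      (mom_nn M (Xs i) (last J) + mom_nn M (X i) (last J)) * ennreal \<bar>?R J\<bar>)" for i
  proof -
    have "ennreal \<bar>A i\<bar> \<le> (\<Sum>d=1..N. \<Sum>J\<in>multi_idx d N.
      ennreal \<bar>mom_idx M (X i) (butlast J) * (mom M (Xs i) (last J) - mom M (X i) (last J)) * ?R J\<bar>)"
      unfolding A_def by (intro order_trans[OF ennreal_abs_sum_le] sum_mono)
         (auto simp: abs_mult[of "(-1) ^ _"] power_abs intro!: ennreal_abs_sum_le)
    also have "\<dots> \<le> (\<Sum>d=1..N. \<Sum>J\<in>multi_idx d N. mom_idx_nn M (X i) (butlast J) *
      (mom_nn M (Xs i) (last J) + mom_nn M (X i) (last J)) * ennreal \<bar>?R J\<bar>)"
      unfolding ennreal_abs_mult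
      by (intro sum_mono mult_mono mom_idx_le_mom_idx_nn order_trans[OF ennreal_abs_diff_le]
            add_mono mom_le_mom_nn) auto
    finally show ?thesis .
  qed
  have B: "ennreal \<bar>B i\<bar> \<le> C * (\<Sum>k=0..N. mom_nn M (Xs i) k *
           (\<Sum>d=0..N - k. \<Sum>J\<in>multi_idx d (N - k).
              mom_idx_nn M (X i) J *
              (pmom_nn M (?W i) p * mom_nn M (X i) (N - k - sum_list J + 1)
               + mom_pow_nn M (X i) (N - k - sum_list J + 1) p)))" if "i \<in> {1..n}" for i
  proof -
    have "ennreal \<bar>B i\<bar> \<le> (\<Sum>k=0..N. mom_nn M (Xs i) k *
           (C * (\<Sum>d=0..N - k. \<Sum>J\<in>multi_idx d (N - k).
              mom_idx_nn M (X i) J *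
              (pmom_nn M (?W i) p * mom_nn M (X i) (N - k - sum_list J + 1)
               + mom_pow_nn M (X i) (N - k - sum_list J + 1) p))))"
    unfolding B_def
    proof (intro order_trans[OF ennreal_abs_sum_le] sum_mono, unfold ennreal_abs_mult,
           intro mult_mono mom_le_mom_nn)
      \<comment> \<open>Since k \<le> N, the orders N - k and k add up to N, so the
        \<open>eps\<close> bound involves exactly the norm contained in C.\<close>
      fix k assume "k \<in> {0..N}"
      then show "ennreal \<bar>eps M (N - k) ((fdiff ^^ k) ?f) (?W i) (X i)\<bar> \<le>
        C * (\<Sum>d=0..N - k. \<Sum>J\<in>multi_idx d (N - k).
              mom_idx_nn M (X i) J *
              (pmom_nn M (?W i) p * mom_nn M (X i) (N - k - sum_list J + 1)
               + mom_pow_nn M (X i) (N - k - sum_list J + 1) p))"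
        using eps_stein_shift_le[OF assms(1) X[OF that], of "N - k" k M n X h] by (simp add: C)
    qed auto
    also have "\<dots> = C * (\<Sum>k=0..N. mom_nn M (Xs i) k *
           (\<Sum>d=0..N - k. \<Sum>J\<in>multi_idx d (N - k).
              mom_idx_nn M (X i) J *
              (pmom_nn M (?W i) p * mom_nn M (X i) (N - k - sum_list J + 1)
               + mom_pow_nn M (X i) (N - k - sum_list J + 1) p)))"
      by (simp add: sum_distrib_left mult.left_commute)
    finally show ?thesis .
  qed
  have D: "ennreal \<bar>D i\<bar> \<le> C * (pmom_nn M (?W i) p * mom_nn M (Xs i) (N + 1)
              + mom_pow_nn M (Xs i) (N + 1) p)" if "i \<in> {1..n}" for i
    using delta_stein_shift_le[OF assms(1) Xs[OF that], of N 0 M n X h] by (simp add: C D_def)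
  have mean: "mean M Y \<ge> 0" for Y :: "'a \<Rightarrow> nat"
    by (simp add: mean_def)
  have "stein_rem M n X Xs N h = (\<Sum>i=1..n. mean M (X i) * (A i + B i + D i))"
    unfolding A_def B_def D_def N by (rule stein_rem.simps(2))
  also have "ennreal \<bar>\<dots>\<bar> \<le> (\<Sum>i=1..n. ennreal (mean M (X i)) *
      (ennreal \<bar>A i\<bar> + ennreal \<bar>B i\<bar> + ennreal \<bar>D i\<bar>))"
    by (intro order_trans[OF ennreal_abs_sum_le] sum_mono)
       (simp add: ennreal_abs_mult mean mult_left_mono ennreal_abs_add3_le)
  also have "\<dots> \<le> (\<Sum>i=1..n. ennreal (mean M (X i)) *
      ((\<Sum>d=1..N. \<Sum>J\<in>multi_idx d N.
          mom_idx_nn M (X i) (butlast J) *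
          (mom_nn M (Xs i) (last J) + mom_nn M (X i) (last J)) * ennreal \<bar>?R J\<bar>)
       + C * (\<Sum>k=0..N. mom_nn M (Xs i) k *
           (\<Sum>d=0..N - k. \<Sum>J\<in>multi_idx d (N - k).
              mom_idx_nn M (X i) J *
              (pmom_nn M (?W i) p * mom_nn M (X i) (N - k - sum_list J + 1)
               + mom_pow_nn M (X i) (N - k - sum_list J + 1) p)))
       + C * (pmom_nn M (?W i) p * mom_nn M (Xs i) (N + 1)
              + mom_pow_nn M (Xs i) (N + 1) p)))"
    by (intro sum_mono mult_left_mono add_mono A B D) auto
  finally show ?thesis .
qed

section \<open>The Stein equation\<close>

lemma npow_mult: "npow (a * b) p = npow a p * npow b p"
  by (simp add: npow_def powr_mult)

lemma one_le_npow_Suc: "0 \<le> p \<Longrightarrow> 1 \<le> npow (x + 1) p"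
  by (simp add: npow_def ge_one_powr_ge_zero)

text \<open>With \<open>x + 1\<close> in place of x the comparison function is at least 1
  everywhere, so the finitely many values of h below the threshold are absorbed by adding their
  absolute values to the constant.\<close>

lemma bigo_npow_imp_bound:
  assumes "h \<in> O(\<lambda>x. npow x p)" "0 \<le> p"
  obtains K where "0 \<le> K" "\<And>x. \<bar>h x\<bar> \<le> K * npow (x + 1) p"
proof -
  obtain c where "0 < c" and "\<forall>\<^sub>F x in at_top. norm (h x) \<le> c * norm (npow x p)"
    using assms(1) by (elim landau_o.bigE)
  then obtain n where n: "\<And>x. n \<le> x \<Longrightarrow> \<bar>h x\<bar> \<le> c * npow x p"
    by (auto simp: eventually_at_top_linorder)
  let ?K = "c + (\<Sum>i<n. \<bar>h i\<bar>)"
  show ?thesis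
  proof
    show "0 \<le> ?K"
      using \<open>0 < c\<close> by (simp add: sum_nonneg)
    fix x
    show "\<bar>h x\<bar> \<le> ?K * npow (x + 1) p"
    proof (cases "x < n")
      case True
      then have "\<bar>h x\<bar> \<le> (\<Sum>i<n. \<bar>h i\<bar>)"
        by (intro member_le_sum) auto
      then have "\<bar>h x\<bar> \<le> ?K * 1"
        using \<open>0 < c\<close> by simp
      also have "\<dots> \<le> ?K * npow (x + 1) p"
        using \<open>0 \<le> ?K\<close> one_le_npow_Suc[OF assms(2)] by (intro mult_left_mono)
      finally show ?thesis .
    next
      case False
      then have "\<bar>h x\<bar> \<le> c * npow x p"
        using n by simp
      also have "\<dots> \<le> ?K * npow (x + 1) p"
        using \<open>0 < c\<close> assms(2) by (intro mult_mono npow_mono) (auto simp: sum_nonneg)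
      finally show ?thesis .
    qed
  qed
qed

text \<open>Since \<open>npow (i + 1) p\<close> is O(2^i), the terms are dominated, up to a
  constant, by those of the exponential series at \<open>2 * l\<close>.\<close>

lemma summable_poisson_npow:
  assumes "0 \<le> l"
  shows "summable (\<lambda>i. l ^ i / fact i * npow (i + 1) p)"
proof (rule summable_comparison_test_bigo)
  have "summable (\<lambda>i. (2 * l) ^ i / fact i)"
    using summable_exp[of "2 * l"] by (simp add: divide_inverse mult.commute)
  then show "summable (\<lambda>i. norm (l ^ i / fact i * 2 ^ i))"
    using assms by (simp add: power_mult_distrib mult.commute)
  have "(\<lambda>i. npow (i + 1) p) \<in> O(\<lambda>i. 2 ^ i)"
  proof (cases "p = 0")
    case True
    then show ?thesis unfolding npow_def by simp real_asymp
  next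
    case False
    then show ?thesis unfolding npow_def by simp real_asymp
  qed
  then show "(\<lambda>i. l ^ i / fact i * npow (i + 1) p) \<in> O(\<lambda>i. l ^ i / fact i * 2 ^ i)"
    by (rule landau_o.big.mult_left)
qed

text \<open>The Stein solution is defined by an unordered sum over \<open>{x..}\<close>. Absolute
  summability identifies it with an ordinary series, whose terms can be split off and
  compared.\<close>

lemma infsum_atLeast_eq_suminf:
  fixes a :: "nat \<Rightarrow> real"
  assumes "summable (\<lambda>i. \<bar>a i\<bar>)"
  shows "infsum a {x..} = (\<Sum>j. a (x + j))"
proof -
  have "summable (\<lambda>j. norm (a (x + j)))"
    using summable_iff_shift[of "\<lambda>i. \<bar>a i\<bar>" x] assms by (simp add: add.commute)
  then have "((\<lambda>j. a (x + j)) has_sum (\<Sum>j. a (x + j))) UNIV"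
    by (intro norm_summable_imp_has_sum summable_sums) (auto intro: summable_norm_cancel)
  moreover have "{x..} = (+) x ` UNIV"
    by (auto simp: image_iff intro: le_Suc_ex)
  ultimately show ?thesis
    by (simp add: infsum_reindex comp_def infsumI)
qed

text \<open>The growth condition on h with a constant K valid at every point, as supplied by
  \<open>bigo_npow_imp_bound\<close>; l is the Poisson parameter.\<close>

locale stein_growth =
  fixes l p K :: real and h :: "nat \<Rightarrow> real"
  assumes l: "0 < l" and p: "0 \<le> p" and K: "0 \<le> K" and h: "\<bar>h x\<bar> \<le> K * npow (x + 1) p"
begin

text \<open>The summand of the Stein solution. Its weights are those of the Poisson law without the
  factor \<open>exp (- l)\<close>.\<close>

definition centred :: "nat \<Rightarrow> real" where
  "centred i = l ^ i / fact i * (h i - poisson_exp l h)"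

lemma abs_diff_poisson_exp_le: "\<bar>h x - poisson_exp l h\<bar> \<le> (K + \<bar>poisson_exp l h\<bar>) * npow (x + 1) p"
proof -
  have "\<bar>poisson_exp l h\<bar> * 1 \<le> \<bar>poisson_exp l h\<bar> * npow (x + 1) p"
    by (intro mult_left_mono one_le_npow_Suc p) auto
  then show ?thesis
    using h[of x] by (simp add: algebra_simps)
qed

lemma summable_abs_poisson: "summable (\<lambda>i. \<bar>l ^ i / fact i * h i\<bar>)"
proof (rule summable_comparison_test')
  show "summable (\<lambda>i. K * (l ^ i / fact i * npow (i + 1) p))"
    using l by (intro summable_mult summable_poisson_npow) auto
  fix i :: nat
  have "l ^ i / fact i * \<bar>h i\<bar> \<le> l ^ i / fact i * (K * npow (i + 1) p)"
    using l by (intro mult_left_mono h) auto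
  then show "norm \<bar>l ^ i / fact i * h i\<bar> \<le> K * (l ^ i / fact i * npow (i + 1) p)"
    using l by (simp add: abs_mult mult_ac)
qed

lemma poisson_exp_sums: "(\<lambda>i. l ^ i / fact i * h i) sums (exp l * poisson_exp l h)"
proof -
  have *: "summable (\<lambda>i. \<bar>l ^ i / fact i * exp (- l) * h i\<bar>)"
    using summable_mult[OF summable_abs_poisson, of "exp (- l)"] by (simp add: abs_mult mult_ac)
  have "poisson_exp l h = (\<integral>i. l ^ i / fact i * exp (- l) * h i \<partial>count_space UNIV)"
    unfolding poisson_exp_def measure_pmf_eq_density using l
    by (subst integral_density) (auto simp: pmf_poisson)
  also have "\<dots> = (\<Sum>i. l ^ i / fact i * exp (- l) * h i)"
    using * by (intro integral_count_space_nat) (simp add: integrable_count_space_nat_iff)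
  finally have "(\<lambda>i. l ^ i / fact i * exp (- l) * h i) sums poisson_exp l h"
    using summable_rabs_cancel[OF *] by (simp add: summable_sums)
  from sums_mult[OF this, of "exp l"] show ?thesis
    by (simp add: exp_minus field_simps)
qed

text \<open>The weights \<open>l ^ i / fact i\<close> add up to \<open>exp l\<close>, so subtracting
  the Poisson mean cancels the whole sum. This provides the Stein equation at 0.\<close>

lemma centred_sums: "centred sums 0"
proof -
  have "(\<lambda>i. l ^ i / fact i) sums exp l"
    using exp_converges[of l] by (simp add: divide_inverse mult.commute)
  from sums_diff[OF poisson_exp_sums sums_mult2[OF this, of "poisson_exp l h"]] show ?thesis
    unfolding centred_def[abs_def] right_diff_distrib by (simp add: mult.commute)
qed

lemma summable_abs_centred: "summable (\<lambda>i. \<bar>centred i\<bar>)"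
proof (rule summable_comparison_test')
  let ?K = "K + \<bar>poisson_exp l h\<bar>"
  show "summable (\<lambda>i. ?K * (l ^ i / fact i * npow (i + 1) p))"
    using l by (intro summable_mult summable_poisson_npow) auto
  fix i :: nat
  have "l ^ i / fact i * \<bar>h i - poisson_exp l h\<bar> \<le> l ^ i / fact i * (?K * npow (i + 1) p)"
    using l by (intro mult_left_mono abs_diff_poisson_exp_le) auto
  then show "norm \<bar>centred i\<bar> \<le> ?K * (l ^ i / fact i * npow (i + 1) p)"
    using l by (simp add: centred_def abs_mult mult_ac)
qed

lemma stein_sol_eq: "stein_sol l h x = fact (x - 1) / l ^ x * (\<Sum>j. centred (x + j))"
  unfolding stein_sol_def centred_def[symmetric]
  by (simp add: infsum_atLeast_eq_suminf[OF summable_abs_centred])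

text \<open>The tails starting at x and at x + 1 differ by the single term \<open>centred x\<close>,
  and the factor \<open>fact x / l ^ x\<close> turns this term into the right side.\<close>

lemma stein_equation: "real x * stein_sol l h x - l * stein_sol l h (x + 1) = h x - poisson_exp l h"
proof -
  have "summable (\<lambda>j. centred (j + x))"
    using summable_rabs_cancel[OF summable_abs_centred] by (simp add: summable_iff_shift)
  then have "(\<Sum>j. centred (x + j)) = centred x + (\<Sum>j. centred (x + 1 + j))"
    using suminf_split_head[of "\<lambda>j. centred (j + x)"] by (simp add: add.commute)
  then have *: "fact x / l ^ x * (\<Sum>j. centred (x + j)) - fact x / l ^ x * (\<Sum>j. centred (x + 1 + j))
      = h x - poisson_exp l h"
    using l by (simp add: centred_def field_simps)
  have "l * stein_sol l h (x + 1) = fact x / l ^ x * (\<Sum>j. centred (x + 1 + j))"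
    using l unfolding stein_sol_eq by (simp add: field_simps)
  moreover have "real x * stein_sol l h x = fact x / l ^ x * (\<Sum>j. centred (x + j))"
  proof (cases x)
    \<comment> \<open>The left side vanishes whatever \<open>stein_sol l h 0\<close> is, and the
      right side is the complete series, whose sum is 0.\<close>
    case 0
    then show ?thesis
      using centred_sums by (simp add: sums_iff)
  next
    case (Suc y)
    then show ?thesis
      unfolding stein_sol_eq by simp
  qed
  ultimately show ?thesis
    using * by simp
qed

text \<open>In each summand the power \<open>l ^ x\<close> cancels and the dependence on x is
  separated from that on j. What remains is a convergent series in j that does not depend on
  x.\<close>

lemma stein_sol_bound:
  obtains B where "0 \<le> B" "\<And>x. 1 \<le> x \<Longrightarrow> \<bar>stein_sol l h x\<bar> \<le> B * npow (x + 1) p"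
proof
  let ?K = "K + \<bar>poisson_exp l h\<bar>"
  define w where "w j = l ^ j / fact j * npow (j + 1) p" for j
  have w: "summable w"
    using l unfolding w_def by (intro summable_poisson_npow) auto
  show "0 \<le> ?K * suminf w"
    using l K by (intro mult_nonneg_nonneg suminf_nonneg w) (auto simp: w_def)
  fix x :: nat
  assume x: "1 \<le> x"
  let ?t = "\<lambda>j. fact (x - 1) / l ^ x * centred (x + j)"
  have t: "\<bar>?t j\<bar> \<le> ?K * npow (x + 1) p * w j" for j
  proof -
    \<comment> \<open>The product of the factorials of a and b divides the factorial of a + b, here
      with a = x - 1 and b = j. This bounds the quotient of factorials in \<open>?t j\<close> by
      \<open>1 / fact j\<close>.\<close>
    have "fact (x - 1) * fact j \<le> (fact (x - 1 + j) :: nat)"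
      by (intro dvd_imp_le fact_fact_dvd_fact) auto
    also have "\<dots> \<le> fact (x + j)"
      by (intro fact_mono_nat) auto
    finally have "real (fact (x - 1) * fact j) \<le> real (fact (x + j))"
      by (rule of_nat_mono)
    then have fact_le: "fact (x - 1) / fact (x + j) \<le> 1 / (fact j :: real)"
      by (simp add: field_simps)
    have "\<bar>h (x + j) - poisson_exp l h\<bar> \<le> ?K * npow (x + j + 1) p"
      by (rule abs_diff_poisson_exp_le)
    \<comment> \<open>\<open>x + j + 1\<close> is at most \<open>(x + 1) * (j + 1)\<close>, and
      \<open>npow\<close> is multiplicative, so the growth factor splits.\<close>
    also have "\<dots> \<le> ?K * npow ((x + 1) * (j + 1)) p"
      using K p by (intro mult_left_mono npow_mono) auto
    finally have h_le: "\<bar>h (x + j) - poisson_exp l h\<bar> \<le> ?K * (npow (x + 1) p * npow (j + 1) p)"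
      by (simp only: npow_mult)
    have "\<bar>?t j\<bar> = l ^ j * (fact (x - 1) / fact (x + j)) * \<bar>h (x + j) - poisson_exp l h\<bar>"
      using l by (simp add: centred_def abs_mult power_add)
    also have "\<dots> \<le> l ^ j * (1 / fact j) * (?K * (npow (x + 1) p * npow (j + 1) p))"
      using l by (intro mult_mono fact_le h_le order_refl) auto
    finally show ?thesis
      by (simp add: w_def mult_ac)
  qed
  have tw: "summable (\<lambda>j. ?K * npow (x + 1) p * w j)"
    by (intro summable_mult w)
  have st: "summable (\<lambda>j. \<bar>?t j\<bar>)"
    by (rule summable_comparison_test'[OF tw]) (use t in simp)
  have "summable (\<lambda>j. centred (x + j))"
    using summable_rabs_cancel[OF summable_abs_centred] summable_iff_shift[of centred x]
    by (simp add: add.commute)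
  then have "stein_sol l h x = (\<Sum>j. ?t j)"
    unfolding stein_sol_eq by (rule suminf_mult[symmetric])
  also have "\<bar>\<dots>\<bar> \<le> (\<Sum>j. \<bar>?t j\<bar>)"
    by (rule summable_rabs[OF st])
  also have "\<dots> \<le> (\<Sum>j. ?K * npow (x + 1) p * w j)"
    by (rule suminf_le[OF t st tw])
  also have "\<dots> = ?K * suminf w * npow (x + 1) p"
    by (subst suminf_mult[OF w]) (simp add: mult_ac)
  finally show "\<bar>stein_sol l h x\<bar> \<le> ?K * suminf w * npow (x + 1) p" .
qed

end

section \<open>Zero biasing of one summand\<close>

text \<open>Fubini for the product of the two laws, pulled back to M: the outer point \<omega>
  freezes Y, and \<omega>' is a fresh variable over which Z is integrated.\<close>

lemma (in prob_space) indep_var_integral_fst: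
  fixes F :: "'b \<times> 'b \<Rightarrow> real"
  assumes indep: "indep_var S Y T Z" and F [measurable]: "F \<in> borel_measurable (S \<Otimes>\<^sub>M T)"
    and int: "integrable M (\<lambda>\<omega>. F (Y \<omega>, Z \<omega>))"
  shows "integrable M (\<lambda>\<omega>. \<integral>\<omega>'. F (Y \<omega>, Z \<omega>') \<partial>M)"
    and "AE \<omega> in M. integrable M (\<lambda>\<omega>'. F (Y \<omega>, Z \<omega>'))"
    and "(\<integral>\<omega>. F (Y \<omega>, Z \<omega>) \<partial>M) = (\<integral>\<omega>. \<integral>\<omega>'. F (Y \<omega>, Z \<omega>') \<partial>M \<partial>M)"
proof -
  have [measurable]: "random_variable S Y" "random_variable T Z"
    and joint: "distr M S Y \<Otimes>\<^sub>M distr M T Z = distr M (S \<Otimes>\<^sub>M T) (\<lambda>\<omega>. (Y \<omega>, Z \<omega>))"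
    using indep by (auto simp: indep_var_distribution_eq)
  interpret Y: prob_space "distr M S Y" by (rule prob_space_distr) measurable
  interpret Z: prob_space "distr M T Z" by (rule prob_space_distr) measurable
  interpret YZ: pair_prob_space "distr M S Y" "distr M T Z" ..
  have int': "integrable (distr M S Y \<Otimes>\<^sub>M distr M T Z) F"
    unfolding joint using int by (subst integrable_distr_eq) auto
  have inner: "(\<integral>z. F (y, z) \<partial>distr M T Z) = (\<integral>\<omega>'. F (y, Z \<omega>') \<partial>M)" if "y \<in> space S" for y
    using that by (subst integral_distr) auto
  have Y_space: "Y \<omega> \<in> space S" if "\<omega> \<in> space M" for \<omega>
    using that by (rule measurable_space[rotated]) measurable
  have "integrable M (\<lambda>\<omega>. \<integral>z. F (Y \<omega>, z) \<partial>distr M T Z)"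
    using YZ.integrable_fst'[OF int'] by (subst (asm) integrable_distr_eq) auto
  then show "integrable M (\<lambda>\<omega>. \<integral>\<omega>'. F (Y \<omega>, Z \<omega>') \<partial>M)"
    by (rule Bochner_Integration.integrable_cong[THEN iffD1, rotated 2]) (auto simp: inner Y_space)
  have "AE \<omega> in M. integrable (distr M T Z) (\<lambda>z. F (Y \<omega>, z))"
    using YZ.AE_integrable_fst'[OF int'] by (subst (asm) AE_distr_iff) auto
  then show "AE \<omega> in M. integrable M (\<lambda>\<omega>'. F (Y \<omega>, Z \<omega>'))"
  proof (rule AE_mp, intro AE_I2 impI)
    fix \<omega> assume "\<omega> \<in> space M" "integrable (distr M T Z) (\<lambda>z. F (Y \<omega>, z))"
    then show "integrable M (\<lambda>\<omega>'. F (Y \<omega>, Z \<omega>'))"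
      using Y_space by (subst (asm) integrable_distr_eq) auto
  qed
  have "(\<integral>\<omega>. F (Y \<omega>, Z \<omega>) \<partial>M) = (\<integral>q. F q \<partial>distr M (S \<Otimes>\<^sub>M T) (\<lambda>\<omega>. (Y \<omega>, Z \<omega>)))"
    by (subst integral_distr) auto
  also have "\<dots> = (\<integral>y. \<integral>z. F (y, z) \<partial>distr M T Z \<partial>distr M S Y)"
    using YZ.integral_fst'[OF int'] by (simp add: joint)
  also have "\<dots> = (\<integral>\<omega>. \<integral>z. F (Y \<omega>, z) \<partial>distr M T Z \<partial>M)"
    by (subst integral_distr) auto
  also have "\<dots> = (\<integral>\<omega>. \<integral>\<omega>'. F (Y \<omega>, Z \<omega>') \<partial>M \<partial>M)"
    by (intro Bochner_Integration.integral_cong refl inner Y_space)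
  finally show "(\<integral>\<omega>. F (Y \<omega>, Z \<omega>) \<partial>M) = (\<integral>\<omega>. \<integral>\<omega>'. F (Y \<omega>, Z \<omega>') \<partial>M \<partial>M)" .
qed

text \<open>The converse direction, from iterated integrals to joint integrability. It serves for
  the zero biased variable, where joint integrability is not known beforehand.\<close>

lemma (in prob_space) indep_var_Fubini_integrable:
  fixes F :: "'b \<times> 'b \<Rightarrow> real"
  assumes indep: "indep_var S Y T Z" and F [measurable]: "F \<in> borel_measurable (S \<Otimes>\<^sub>M T)"
    and outer: "integrable M (\<lambda>\<omega>. \<integral>\<omega>'. \<bar>F (Y \<omega>, Z \<omega>')\<bar> \<partial>M)"
    and inner: "AE \<omega> in M. integrable M (\<lambda>\<omega>'. F (Y \<omega>, Z \<omega>'))"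
  shows "integrable M (\<lambda>\<omega>. F (Y \<omega>, Z \<omega>))"
proof -
  have [measurable]: "random_variable S Y" "random_variable T Z"
    and joint: "distr M S Y \<Otimes>\<^sub>M distr M T Z = distr M (S \<Otimes>\<^sub>M T) (\<lambda>\<omega>. (Y \<omega>, Z \<omega>))"
    using indep by (auto simp: indep_var_distribution_eq)
  interpret Y: prob_space "distr M S Y" by (rule prob_space_distr) measurable
  interpret Z: prob_space "distr M T Z" by (rule prob_space_distr) measurable
  interpret YZ: pair_prob_space "distr M S Y" "distr M T Z" ..
  have Y_space: "Y \<omega> \<in> space S" if "\<omega> \<in> space M" for \<omega>
    using that by (rule measurable_space[rotated]) measurable
  have "integrable M (\<lambda>\<omega>. \<integral>z. norm (F (Y \<omega>, z)) \<partial>distr M T Z)"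
    using outer
    by (rule Bochner_Integration.integrable_cong[THEN iffD1, rotated 2])
       (auto simp: Y_space integral_distr)
  then have "integrable (distr M S Y) (\<lambda>y. \<integral>z. norm (F (y, z)) \<partial>distr M T Z)"
    by (subst integrable_distr_eq) auto
  moreover have "AE \<omega> in M. integrable (distr M T Z) (\<lambda>z. F (Y \<omega>, z))"
    using inner
  proof (rule AE_mp, intro AE_I2 impI)
    fix \<omega> assume "\<omega> \<in> space M" "integrable M (\<lambda>\<omega>'. F (Y \<omega>, Z \<omega>'))"
    then show "integrable (distr M T Z) (\<lambda>z. F (Y \<omega>, z))"
      using Y_space by (subst integrable_distr_eq) auto
  qed
  then have "AE y in distr M S Y. integrable (distr M T Z) (\<lambda>z. F (y, z))"
    by (subst AE_distr_iff) auto
  ultimately have "integrable (distr M S Y \<Otimes>\<^sub>M distr M T Z) F"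
    by (intro YZ.Fubini_integrable) auto
  then show ?thesis
    unfolding joint by (subst (asm) integrable_distr_eq) auto
qed

text \<open>For almost every \<omega> the value of V is frozen and zero biasing is applied to the
  translated function; Fubini on both sides restores the joint expectation.\<close>

lemma (in prob_space) zero_biased_indep:
  fixes f :: "nat \<Rightarrow> real" and V Y Ys :: "'a \<Rightarrow> nat"
  assumes VY: "indep_var (count_space UNIV) V (count_space UNIV) Y"
    and VYs: "indep_var (count_space UNIV) V (count_space UNIV) Ys"
    and zb: "poisson_zero_biased M Y Ys" and mean: "mean M Y > 0"
    and int: "integrable M (\<lambda>\<omega>. real (Y \<omega>) * f (V \<omega> + Y \<omega>))"
  shows "integrable M (\<lambda>\<omega>. f (V \<omega> + Ys \<omega> + 1))"
    and "(\<integral>\<omega>. real (Y \<omega>) * f (V \<omega> + Y \<omega>) \<partial>M) = mean M Y * (\<integral>\<omega>. f (V \<omega> + Ys \<omega> + 1) \<partial>M)"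
proof -
  let ?C = "count_space (UNIV :: nat set)"
  let ?F = "\<lambda>q. real (snd q) * f (fst q + snd q)" and ?G = "\<lambda>q. f (fst q + snd q + 1)"
  \<comment> \<open>Pairs of natural numbers form a countable discrete space, so every function on
    them is measurable.\<close>
  have meas [measurable]: "H \<in> borel_measurable (?C \<Otimes>\<^sub>M ?C)" for H :: "nat \<times> nat \<Rightarrow> real"
    by (simp add: pair_measure_countable)
  have int_abs: "integrable M (\<lambda>\<omega>. real (Y \<omega>) * \<bar>f (V \<omega> + Y \<omega>)\<bar>)"
    using integrable_norm[OF int] by (simp add: abs_mult)
  note fst = indep_var_integral_fst[OF VY, of ?F, OF meas]
  note fst_abs = indep_var_integral_fst[OF VY, of "\<lambda>q. real (snd q) * \<bar>f (fst q + snd q)\<bar>", OF meas]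
  have AE: "AE \<omega> in M. integrable M (\<lambda>\<omega>'. real (Y \<omega>') * f (V \<omega> + Y \<omega>'))"
    using fst(2) int by simp
  have "AE \<omega> in M. integrable M (\<lambda>\<omega>'. f (V \<omega> + Ys \<omega>' + 1)) \<and>
      (\<integral>\<omega>'. real (Y \<omega>') * f (V \<omega> + Y \<omega>') \<partial>M) = mean M Y * (\<integral>\<omega>'. f (V \<omega> + Ys \<omega>' + 1) \<partial>M) \<and>
      (\<integral>\<omega>'. real (Y \<omega>') * \<bar>f (V \<omega> + Y \<omega>')\<bar> \<partial>M) = mean M Y * (\<integral>\<omega>'. \<bar>f (V \<omega> + Ys \<omega>' + 1)\<bar> \<partial>M)"
    using AE
  proof eventually_elim
    case (elim \<omega>)
    \<comment> \<open>Zero biasing is applied both to f and to its absolute value: the first gives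
      the identity, the second controls the absolute integrals that Fubini needs on the side of
      \<open>Ys\<close>.\<close>
    have "integrable M (\<lambda>\<omega>'. real (Y \<omega>') * \<bar>f (V \<omega> + Y \<omega>')\<bar>)"
      using integrable_norm[OF elim] by (simp add: abs_mult)
    then show ?case
      using zb[unfolded poisson_zero_biased_def, rule_format, of "\<lambda>x. f (V \<omega> + x)"]
        zb[unfolded poisson_zero_biased_def, rule_format, of "\<lambda>x. \<bar>f (V \<omega> + x)\<bar>"] elim
      by (simp add: add.assoc)
  qed
  then have AE1: "AE \<omega> in M. integrable M (\<lambda>\<omega>'. f (V \<omega> + Ys \<omega>' + 1))"
    and AE2: "AE \<omega> in M. (\<integral>\<omega>'. real (Y \<omega>') * f (V \<omega> + Y \<omega>') \<partial>M)
      = mean M Y * (\<integral>\<omega>'. f (V \<omega> + Ys \<omega>' + 1) \<partial>M)"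
    and AE3: "AE \<omega> in M. (\<integral>\<omega>'. real (Y \<omega>') * \<bar>f (V \<omega> + Y \<omega>')\<bar> \<partial>M)
      = mean M Y * (\<integral>\<omega>'. \<bar>f (V \<omega> + Ys \<omega>' + 1)\<bar> \<partial>M)"
    by (auto simp: AE_conj_iff)
  have [measurable]: "V \<in> M \<rightarrow>\<^sub>M ?C" "Y \<in> M \<rightarrow>\<^sub>M ?C" "Ys \<in> M \<rightarrow>\<^sub>M ?C"
    using VY VYs by (auto simp: indep_var_distribution_eq)
  \<comment> \<open>An inner integral depends on \<omega> only through the natural number
    \<open>V \<omega>\<close>, hence is measurable; exchanging integrands that agree almost
    everywhere relies on this.\<close>
  have inner [measurable]: "(\<lambda>\<omega>. H (V \<omega>)) \<in> borel_measurable M" for H :: "nat \<Rightarrow> real"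
    by measurable
  have "integrable M (\<lambda>\<omega>. \<integral>\<omega>'. real (Y \<omega>') * \<bar>f (V \<omega> + Y \<omega>')\<bar> \<partial>M)"
    using fst_abs(1) int_abs by simp
  then have "integrable M (\<lambda>\<omega>. mean M Y * (\<integral>\<omega>'. \<bar>f (V \<omega> + Ys \<omega>' + 1)\<bar> \<partial>M))"
    by (rule integrable_cong_AE_imp)
       (use AE3 inner[of "\<lambda>v. mean M Y * (\<integral>\<omega>'. \<bar>f (v + Ys \<omega>' + 1)\<bar> \<partial>M)"] in auto)
  then have "integrable M (\<lambda>\<omega>. \<integral>\<omega>'. \<bar>f (V \<omega> + Ys \<omega>' + 1)\<bar> \<partial>M)"
    using mean by simp
  then show G: "integrable M (\<lambda>\<omega>. f (V \<omega> + Ys \<omega> + 1))"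
    using indep_var_Fubini_integrable[OF VYs, of ?G, OF meas] AE1 by simp
  have "(\<integral>\<omega>. real (Y \<omega>) * f (V \<omega> + Y \<omega>) \<partial>M) = (\<integral>\<omega>. \<integral>\<omega>'. real (Y \<omega>') * f (V \<omega> + Y \<omega>') \<partial>M \<partial>M)"
    using fst(3) int by simp
  also have "\<dots> = (\<integral>\<omega>. mean M Y * (\<integral>\<omega>'. f (V \<omega> + Ys \<omega>' + 1) \<partial>M) \<partial>M)"
    by (rule integral_cong_AE)
       (use AE2 inner[of "\<lambda>v. mean M Y * (\<integral>\<omega>'. f (v + Ys \<omega>' + 1) \<partial>M)"]
         inner[of "\<lambda>v. \<integral>\<omega>'. real (Y \<omega>') * f (v + Y \<omega>') \<partial>M"] in auto)
  also have "\<dots> = mean M Y * (\<integral>\<omega>. f (V \<omega> + Ys \<omega> + 1) \<partial>M)"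
    using indep_var_integral_fst(3)[OF VYs, of ?G, OF meas] G by simp
  finally show "(\<integral>\<omega>. real (Y \<omega>) * f (V \<omega> + Y \<omega>) \<partial>M) = mean M Y * (\<integral>\<omega>. f (V \<omega> + Ys \<omega> + 1) \<partial>M)" .
qed

section \<open>The remainder of order 0\<close>

lemma integrable_npow_add:
  assumes [measurable]: "Y \<in> M \<rightarrow>\<^sub>M count_space UNIV" "Z \<in> M \<rightarrow>\<^sub>M count_space UNIV" and q: "0 \<le> q"
    and "integrable M (\<lambda>\<omega>. npow (Y \<omega>) q)" "integrable M (\<lambda>\<omega>. npow (Z \<omega>) q)"
  shows "integrable M (\<lambda>\<omega>. npow (Y \<omega> + Z \<omega>) q)"
proof (rule Bochner_Integration.integrable_bound)
  show "integrable M (\<lambda>\<omega>. max (2 powr (q - 1)) 1 * (npow (Y \<omega>) q + npow (Z \<omega>) q))"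
    using assms by (intro integrable_mult_right Bochner_Integration.integrable_add)
  show "AE \<omega> in M. norm (npow (Y \<omega> + Z \<omega>) q) \<le> norm (max (2 powr (q - 1)) 1 * (npow (Y \<omega>) q + npow (Z \<omega>) q))"
    using npow_add_le[OF q] by (intro AE_I2) (simp add: abs_mult)
  show "(\<lambda>\<omega>. npow (Y \<omega> + Z \<omega>) q) \<in> borel_measurable M"
    by measurable
qed

lemma integrable_npow_sum:
  assumes "finite I" "0 < q"
    and "\<And>i. i \<in> I \<Longrightarrow> X i \<in> M \<rightarrow>\<^sub>M count_space UNIV"
    and "\<And>i. i \<in> I \<Longrightarrow> integrable M (\<lambda>\<omega>. npow (X i \<omega>) q)"
  shows "integrable M (\<lambda>\<omega>. npow (\<Sum>i\<in>I. X i \<omega>) q)"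
  using assms(1,3,4)
proof (induction rule: finite_induct)
  case empty
  then show ?case using assms(2) by (simp add: npow_def)
next
  case (insert i I)
  have [measurable]: "(\<lambda>\<omega>. \<Sum>i\<in>I. X i \<omega>) \<in> M \<rightarrow>\<^sub>M count_space UNIV"
    using insert.prems by (intro measurable_sum_nat) auto
  show ?case
    using insert assms(2) by (simp add: integrable_npow_add)
qed

text \<open>For order 0 the sets S are the singletons \<open>{j}\<close> with j < z, and the sum of
  first differences telescopes.\<close>

lemma sum_singletons_fdiff:
  "(\<Sum>S | S \<subseteq> {..<z} \<and> card S = 0 + 1. (fdiff ^^ (0 + 1)) f (y + Min S)) = f (y + z) - f y"
proof -
  have "{S. S \<subseteq> {..<z} \<and> card S = 0 + 1} = (\<lambda>j. {j}) ` {..<z}"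
    by (auto simp: card_1_singleton_iff)
  then have "(\<Sum>S | S \<subseteq> {..<z} \<and> card S = 0 + 1. (fdiff ^^ (0 + 1)) f (y + Min S))
      = (\<Sum>j<z. f (y + Suc j) - f (y + j))"
    by (simp add: sum.reindex fdiff_def)
  also have "\<dots> = f (y + z) - f y"
    by (subst sum_lessThan_telescope) simp
  finally show ?thesis .
qed

lemma delta_0: "delta M 0 f Y Z = (\<integral>\<omega>. f (Y \<omega> + Z \<omega>) - f (Y \<omega>) \<partial>M)"
  unfolding delta_def sum_singletons_fdiff ..

section \<open>First moments\<close>

lemma mom_pow_nn_1: "0 \<le> p \<Longrightarrow> mom_pow_nn M Y 1 p = pmom_nn M Y (p + 1)"
  by (simp add: mom_pow_nn_def pmom_nn_def npow_Suc_exponent)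

lemma mom_nn_1_eq_mean:
  assumes "integrable M (\<lambda>\<omega>. real (Y \<omega>))"
  shows "mom_nn M Y 1 = ennreal (mean M Y)"
  unfolding mom_nn_def mean_def using assms by (simp add: nn_integral_eq_integral)

text \<open>Zero biasing with \<open>f x = x - 1\<close>; if \<open>Y\<close> has no second moment, then the right side is infinite.\<close>

lemma (in prob_space) mean_mult_zero_biased_le:
  assumes [measurable]: "Y \<in> M \<rightarrow>\<^sub>M count_space UNIV"
    and zb: "poisson_zero_biased M Y Ys" and mean: "mean M Y > 0"
  shows "ennreal (mean M Y) * (mom_nn M Ys 1 + mom_nn M Y 1)
    \<le> pmom_nn M Y 2 + ennreal ((mean M Y)\<^sup>2) - ennreal (mean M Y)"
proof -
  \<comment> \<open>A non-integrable variable would have \<open>mean M Y = 0\<close>, so a positive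
    mean already gives a first moment.\<close>
  have Y: "integrable M (\<lambda>\<omega>. real (Y \<omega>))"
    using mean not_integrable_integral_eq by (force simp: mean_def)
  have pmom: "pmom_nn M Y 2 = (\<integral>\<^sup>+\<omega>. ennreal ((real (Y \<omega>))\<^sup>2) \<partial>M)"
    by (simp add: pmom_nn_def npow_def powr_numeral)
  show ?thesis
  proof (cases "integrable M (\<lambda>\<omega>. (real (Y \<omega>))\<^sup>2)")
    case True
    have int: "integrable M (\<lambda>\<omega>. real (Y \<omega>) * (real (Y \<omega>) - 1))"
      using Bochner_Integration.integrable_diff[OF True Y] by (simp add: power2_eq_square algebra_simps)
    from zb[unfolded poisson_zero_biased_def, rule_format, of "\<lambda>x. real x - 1", OF int]
    have Ys: "integrable M (\<lambda>\<omega>. real (Ys \<omega>))"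
      and "(\<integral>\<omega>. real (Y \<omega>) * (real (Y \<omega>) - 1) \<partial>M) = mean M Y * mean M Ys"
      by (auto simp: mean_def)
    moreover have "(\<integral>\<omega>. real (Y \<omega>) * (real (Y \<omega>) - 1) \<partial>M) = (\<integral>\<omega>. (real (Y \<omega>))\<^sup>2 \<partial>M) - mean M Y"
      using Bochner_Integration.integral_diff[OF True Y]
      by (simp add: power2_eq_square algebra_simps mean_def)
    ultimately have eq: "mean M Y * (mean M Ys + mean M Y)
        = (\<integral>\<omega>. (real (Y \<omega>))\<^sup>2 \<partial>M) + (mean M Y)\<^sup>2 - mean M Y"
      by (simp add: power2_eq_square algebra_simps)
    have "0 \<le> mean M Ys"
      by (simp add: mean_def)
    then have "ennreal (mean M Y) * (mom_nn M Ys 1 + mom_nn M Y 1)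
        = ennreal (mean M Y * (mean M Ys + mean M Y))"
      using mean unfolding mom_nn_1_eq_mean[OF Y] mom_nn_1_eq_mean[OF Ys]
      by (simp add: ennreal_mult flip: ennreal_plus)
    also have "\<dots> = pmom_nn M Y 2 + ennreal ((mean M Y)\<^sup>2) - ennreal (mean M Y)"
      unfolding eq pmom using mean True
      by (simp add: nn_integral_eq_integral ennreal_minus flip: ennreal_plus)
    finally show ?thesis by simp
  next
    case False
    then have "pmom_nn M Y 2 = \<infinity>"
      unfolding pmom by (auto simp: integrable_iff_bounded less_top[symmetric])
    then show ?thesis
      by simp
  qed
qed

context prob_space
begin

text \<open>Write V for the sum without the i-th variable. In the i-th term zero biasing produces
  the difference of the expectations of \<open>f (V + Xs i + 1)\<close> and
  \<open>f (V + X i + 1)\<close>; subtracting \<open>f (V + 1)\<close> from both exhibits each as a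
  \<open>delta\<close> of order 0.\<close>

lemma stein_rem_0_eq_delta:
  fixes X Xs :: "nat \<Rightarrow> 'a \<Rightarrow> nat"
  assumes n: "1 \<le> n" and p: "0 \<le> p" and h: "h \<in> O(\<lambda>x. npow x p)"
    and X: "\<And>i. i \<in> {1..n} \<Longrightarrow>
      indep_var (count_space UNIV) (total_without n X i) (count_space UNIV) (X i)"
    and moment: "\<And>i. i \<in> {1..n} \<Longrightarrow> integrable M (\<lambda>\<omega>. npow (X i \<omega>) (p + 1))"
    and mean: "\<And>i. i \<in> {1..n} \<Longrightarrow> mean M (X i) > 0"
    and zb: "\<And>i. i \<in> {1..n} \<Longrightarrow> poisson_zero_biased M (X i) (Xs i)"
    and Xs: "\<And>i. i \<in> {1..n} \<Longrightarrow>
      indep_var (count_space UNIV) (total_without n X i) (count_space UNIV) (Xs i)"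
  shows "stein_rem M n X Xs 0 h = (\<Sum>i=1..n. mean M (X i) *
    (delta M 0 (stein_shift M n X h) (total_without n X i) (Xs i)
      - delta M 0 (stein_shift M n X h) (total_without n X i) (X i)))"
proof -
  define l where "l = total_mean M n X"
  define f where "f = stein_sol l h"
  define W where "W = total n X"
  let ?V = "total_without n X"
  have shift: "stein_shift M n X h x = f (x + 1)" for x
    by (simp add: stein_shift_def f_def l_def)
  have W_eq: "W \<omega> = ?V i \<omega> + X i \<omega>" if "i \<in> {1..n}" for i \<omega>
    using that member_le_sum[of i "{1..n}" "\<lambda>j. X j \<omega>"]
    by (simp add: W_def total_without_def total_def)
  have X_meas: "X i \<in> M \<rightarrow>\<^sub>M count_space UNIV" if "i \<in> {1..n}" for i
    using X[OF that] by (rule indep_var_rv2)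
  have [measurable]: "W \<in> M \<rightarrow>\<^sub>M count_space UNIV"
    unfolding W_def total_def[abs_def] by (intro measurable_sum_nat X_meas)
  have "0 < l"
    unfolding l_def total_mean_def using n mean by (intro sum_pos) auto
  obtain K where "0 \<le> K" "\<And>x. \<bar>h x\<bar> \<le> K * npow (x + 1) p"
    using bigo_npow_imp_bound[OF h p] by blast
  then interpret stein_growth l p K h
    using \<open>0 < l\<close> p by unfold_locales auto
  obtain B where "0 \<le> B" and B: "\<And>x. 1 \<le> x \<Longrightarrow> \<bar>f x\<bar> \<le> B * npow (x + 1) p"
    using stein_sol_bound unfolding f_def by blast
  have "integrable M (\<lambda>\<omega>. npow (W \<omega>) (p + 1))"
    unfolding W_def total_def using p by (intro integrable_npow_sum X_meas moment) auto
  \<comment> \<open>The constant 2 enters as a random variable.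
    \<open>npow (W \<omega> + 2) (p + 1)\<close> times B is the dominating function for all
    integrands below; the 2 appears because the bound on f at W + 1 involves W + 2.\<close>
  from integrable_npow_add[OF _ _ _ this, of "\<lambda>_. 2"]
  have W_moment: "integrable M (\<lambda>\<omega>. npow (W \<omega> + 2) (p + 1))"
    using p by simp
  have growth: "real (W \<omega>) * \<bar>f (W \<omega>)\<bar> \<le> B * npow (W \<omega> + 2) (p + 1)"
    "\<bar>f (W \<omega> + 1)\<bar> \<le> B * npow (W \<omega> + 2) (p + 1)" for \<omega>
  proof -
    \<comment> \<open>Multiplication by x costs one power, whence the exponent p + 1. At x = 0,
      where no bound on f is available, the factor x removes its value.\<close>
    have "real x * \<bar>f x\<bar> \<le> B * npow (x + 2) (p + 1)" for x
    proof (cases "x = 0")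
      case False
      then have "real x * \<bar>f x\<bar> \<le> real (x + 2) * (B * npow (x + 2) p)"
        using \<open>0 \<le> B\<close> p
        by (intro mult_mono order_trans[OF B] mult_left_mono npow_mono) auto
      then show ?thesis
        by (simp add: npow_Suc_exponent[OF p] mult_ac)
    qed (use \<open>0 \<le> B\<close> in simp)
    then show "real (W \<omega>) * \<bar>f (W \<omega>)\<bar> \<le> B * npow (W \<omega> + 2) (p + 1)" .
    have "\<bar>f (W \<omega> + 1)\<bar> \<le> 1 * (B * npow (W \<omega> + 2) p)"
      using B[of "W \<omega> + 1"] by simp
    also have "\<dots> \<le> real (W \<omega> + 2) * (B * npow (W \<omega> + 2) p)"
      using \<open>0 \<le> B\<close> by (intro mult_right_mono) auto
    finally show "\<bar>f (W \<omega> + 1)\<bar> \<le> B * npow (W \<omega> + 2) (p + 1)"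
      by (simp only: npow_Suc_exponent[OF p] mult_ac)
  qed
  have f_W1: "integrable M (\<lambda>\<omega>. f (W \<omega> + 1))"
    by (rule Bochner_Integration.integrable_bound[OF integrable_mult_right[OF W_moment, of B]])
       (use growth(2) \<open>0 \<le> B\<close> in \<open>auto simp: abs_mult\<close>)
  have X_f_W: "integrable M (\<lambda>\<omega>. real (X i \<omega>) * f (W \<omega>))" if i: "i \<in> {1..n}" for i
  proof (rule Bochner_Integration.integrable_bound[OF integrable_mult_right[OF W_moment, of B]])
    have [measurable]: "X i \<in> M \<rightarrow>\<^sub>M count_space UNIV"
      by (rule X_meas[OF i])
    show "(\<lambda>\<omega>. real (X i \<omega>) * f (W \<omega>)) \<in> borel_measurable M"
      by measurable
    have "real (X i \<omega>) * \<bar>f (W \<omega>)\<bar> \<le> real (W \<omega>) * \<bar>f (W \<omega>)\<bar>" for \<omega>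
      using W_eq[OF i] by (intro mult_right_mono) auto
    then show "AE \<omega> in M. norm (real (X i \<omega>) * f (W \<omega>)) \<le> norm (B * npow (W \<omega> + 2) (p + 1))"
      using order_trans[OF _ growth(1)] \<open>0 \<le> B\<close> by (intro AE_I2) (simp add: abs_mult)
  qed
  have W_f_W: "real (W \<omega>) * f (W \<omega>) = (\<Sum>i=1..n. real (X i \<omega>) * f (W \<omega>))" for \<omega>
    by (simp add: W_def total_def sum_distrib_right)
  have int_W_f_W: "integrable M (\<lambda>\<omega>. real (W \<omega>) * f (W \<omega>))"
    unfolding W_f_W by (intro Bochner_Integration.integrable_sum X_f_W)
  have h_eq: "h (W \<omega>) = real (W \<omega>) * f (W \<omega>) - l * f (W \<omega> + 1) + poisson_exp l h" for \<omega>
    using stein_equation[of "W \<omega>"] by (simp add: f_def)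
  have "stein_rem M n X Xs 0 h
      = (\<integral>\<omega>. real (W \<omega>) * f (W \<omega>) - l * f (W \<omega> + 1) + poisson_exp l h \<partial>M) - poisson_exp l h"
    by (simp only: stein_rem.simps l_def[symmetric] W_def[symmetric] h_eq)
  also have "\<dots> = (\<integral>\<omega>. real (W \<omega>) * f (W \<omega>) \<partial>M) - l * (\<integral>\<omega>. f (W \<omega> + 1) \<partial>M)"
    using int_W_f_W f_W1 by (simp add: prob_space)
  also have "\<dots> = (\<Sum>i=1..n. (\<integral>\<omega>. real (X i \<omega>) * f (W \<omega>) \<partial>M) - mean M (X i) * (\<integral>\<omega>. f (W \<omega> + 1) \<partial>M))"
    unfolding W_f_W by (subst Bochner_Integration.integral_sum[OF X_f_W])
       (auto simp: l_def total_mean_def sum_subtractf sum_distrib_right)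
  also have "\<dots> = (\<Sum>i=1..n. mean M (X i) *
    (delta M 0 (stein_shift M n X h) (?V i) (Xs i) - delta M 0 (stein_shift M n X h) (?V i) (X i)))"
  proof (rule sum.cong)
    fix i assume i: "i \<in> {1..n}"
    note W = W_eq[OF i]
    have [measurable]: "?V i \<in> M \<rightarrow>\<^sub>M count_space UNIV"
      using X[OF i] by (rule indep_var_rv1)
    \<comment> \<open>This allows both \<open>delta\<close> integrals to be split, after which the
      common term \<open>f (V + 1)\<close> cancels. As V is at most W, the same dominating function
      works.\<close>
    have f_V1: "integrable M (\<lambda>\<omega>. f (?V i \<omega> + 1))"
    proof (rule Bochner_Integration.integrable_bound[OF integrable_mult_right[OF W_moment, of B]])
      have "\<bar>f (?V i \<omega> + 1)\<bar> \<le> B * npow (W \<omega> + 2) (p + 1)" for \<omega>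
      proof -
        have "\<bar>f (?V i \<omega> + 1)\<bar> \<le> 1 * (B * npow (W \<omega> + 2) p)"
          using B[of "?V i \<omega> + 1"] W[of \<omega>] npow_mono[of "?V i \<omega> + 2" "W \<omega> + 2" p] p \<open>0 \<le> B\<close>
          by (auto intro!: order_trans[OF B] mult_left_mono npow_mono)
        also have "\<dots> \<le> real (W \<omega> + 2) * (B * npow (W \<omega> + 2) p)"
          using \<open>0 \<le> B\<close> by (intro mult_right_mono) auto
        finally show ?thesis
          by (simp only: npow_Suc_exponent[OF p] mult_ac)
      qed
      then show "AE \<omega> in M. norm (f (?V i \<omega> + 1)) \<le> norm (B * npow (W \<omega> + 2) (p + 1))"
        using \<open>0 \<le> B\<close> by (intro AE_I2) (simp add: abs_mult)
    qed measurable
    have zb': "integrable M (\<lambda>\<omega>. f (?V i \<omega> + Xs i \<omega> + 1))"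
      "(\<integral>\<omega>. real (X i \<omega>) * f (W \<omega>) \<partial>M) = mean M (X i) * (\<integral>\<omega>. f (?V i \<omega> + Xs i \<omega> + 1) \<partial>M)"
      using zero_biased_indep[OF X[OF i] Xs[OF i] zb[OF i] mean[OF i], of f] X_f_W[OF i]
      unfolding W by blast+
    have "delta M 0 (stein_shift M n X h) (?V i) (Xs i) - delta M 0 (stein_shift M n X h) (?V i) (X i)
        = (\<integral>\<omega>. f (?V i \<omega> + Xs i \<omega> + 1) \<partial>M) - (\<integral>\<omega>. f (W \<omega> + 1) \<partial>M)"
      unfolding delta_0 shift W[symmetric]
      using zb'(1) f_V1 f_W1 by simp
    then show "(\<integral>\<omega>. real (X i \<omega>) * f (W \<omega>) \<partial>M) - mean M (X i) * (\<integral>\<omega>. f (W \<omega> + 1) \<partial>M)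
      = mean M (X i) *
    (delta M 0 (stein_shift M n X h) (?V i) (Xs i) - delta M 0 (stein_shift M n X h) (?V i) (X i))"
      unfolding zb'(2) by (simp add: right_diff_distrib)
  qed simp
  finally show ?thesis .
qed

text \<open>Each of the two \<open>delta\<close> bounds contains a first moment, of
  \<open>Xs i\<close> and of \<open>X i\<close>. Weighted by the mean, their sum is the left side of
  \<open>mean_mult_zero_biased_le\<close>, which brings in the second moment of
  \<open>X i\<close>.\<close>

lemma stein_rem_0_le:
  fixes X Xs :: "nat \<Rightarrow> 'a \<Rightarrow> nat"
  assumes n: "1 \<le> n" and p: "0 \<le> p" and h: "h \<in> O(\<lambda>x. npow x p)"
    and X: "\<And>i. i \<in> {1..n} \<Longrightarrow>
      indep_var (count_space UNIV) (total_without n X i) (count_space UNIV) (X i)"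
    and moment: "\<And>i. i \<in> {1..n} \<Longrightarrow> integrable M (\<lambda>\<omega>. npow (X i \<omega>) (p + 1))"
    and mean: "\<And>i. i \<in> {1..n} \<Longrightarrow> mean M (X i) > 0"
    and zb: "\<And>i. i \<in> {1..n} \<Longrightarrow> poisson_zero_biased M (X i) (Xs i)"
    and Xs: "\<And>i. i \<in> {1..n} \<Longrightarrow>
      indep_var (count_space UNIV) (total_without n X i) (count_space UNIV) (Xs i)"
  shows "ennreal \<bar>stein_rem M n X Xs 0 h\<bar> \<le>
    ennreal (max (2 powr (p - 1)) 1) * diff_norm 0 p (stein_sol (total_mean M n X) h) *
    (\<Sum>i=1..n.
       pmom_nn M (total_without n X i) p *
         (pmom_nn M (X i) 2 + ennreal ((mean M (X i))\<^sup>2) - ennreal (mean M (X i)))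
       + ennreal (mean M (X i)) * (pmom_nn M (Xs i) (p + 1) + pmom_nn M (X i) (p + 1)))"
    (is "_ \<le> ?C * _")
proof -
  let ?V = "total_without n X" and ?g = "stein_shift M n X h"
  have delta: "ennreal \<bar>delta M 0 ?g (?V i) Z\<bar>
      \<le> ?C * (pmom_nn M (?V i) p * mom_nn M Z 1 + pmom_nn M Z (p + 1))"
    if "indep_var (count_space UNIV) (?V i) (count_space UNIV) Z" for i Z
    using delta_stein_shift_le[OF p that, of 0 0 M n X h] by (simp add: mom_pow_nn_1[OF p, simplified])
  have eq: "stein_rem M n X Xs 0 h
      = (\<Sum>i=1..n. mean M (X i) * (delta M 0 ?g (?V i) (Xs i) - delta M 0 ?g (?V i) (X i)))"
    by (rule stein_rem_0_eq_delta) fact+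
  have "ennreal \<bar>stein_rem M n X Xs 0 h\<bar> \<le> (\<Sum>i=1..n. ennreal (mean M (X i)) *
      (ennreal \<bar>delta M 0 ?g (?V i) (Xs i)\<bar> + ennreal \<bar>delta M 0 ?g (?V i) (X i)\<bar>))"
    unfolding eq
  proof (intro order_trans[OF ennreal_abs_sum_le] sum_mono)
    fix i assume "i \<in> {1..n}"
    then show "ennreal \<bar>mean M (X i) * (delta M 0 ?g (?V i) (Xs i) - delta M 0 ?g (?V i) (X i))\<bar>
      \<le> ennreal (mean M (X i)) *
        (ennreal \<bar>delta M 0 ?g (?V i) (Xs i)\<bar> + ennreal \<bar>delta M 0 ?g (?V i) (X i)\<bar>)"
      using mean[of i] unfolding ennreal_abs_mult
      by (intro mult_mono ennreal_abs_diff_le) auto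
  qed
  also have "\<dots> \<le> (\<Sum>i=1..n. ?C * (
       pmom_nn M (?V i) p * (pmom_nn M (X i) 2 + ennreal ((mean M (X i))\<^sup>2) - ennreal (mean M (X i)))
       + ennreal (mean M (X i)) * (pmom_nn M (Xs i) (p + 1) + pmom_nn M (X i) (p + 1))))"
  proof (rule sum_mono)
    fix i assume i: "i \<in> {1..n}"
    let ?m = "ennreal (mean M (X i))"
    have "?m * (ennreal \<bar>delta M 0 ?g (?V i) (Xs i)\<bar> + ennreal \<bar>delta M 0 ?g (?V i) (X i)\<bar>)
      \<le> ?m * (?C * (pmom_nn M (?V i) p * mom_nn M (Xs i) 1 + pmom_nn M (Xs i) (p + 1))
          + ?C * (pmom_nn M (?V i) p * mom_nn M (X i) 1 + pmom_nn M (X i) (p + 1)))"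
      by (intro mult_left_mono add_mono delta X[OF i] Xs[OF i]) simp
    also have "\<dots> = ?C * (pmom_nn M (?V i) p * (?m * (mom_nn M (Xs i) 1 + mom_nn M (X i) 1))
        + ?m * (pmom_nn M (Xs i) (p + 1) + pmom_nn M (X i) (p + 1)))"
      by (simp only: distrib_left distrib_right mult_ac add_ac)
    also have "\<dots> \<le> ?C * (pmom_nn M (?V i) p *
          (pmom_nn M (X i) 2 + ennreal ((mean M (X i))\<^sup>2) - ?m)
        + ?m * (pmom_nn M (Xs i) (p + 1) + pmom_nn M (X i) (p + 1)))"
      using X[OF i] zb[OF i] mean[OF i]
      by (intro mult_left_mono add_right_mono mean_mult_zero_biased_le) (auto dest: indep_var_rv2)
    finally show "?m * (ennreal \<bar>delta M 0 ?g (?V i) (Xs i)\<bar> + ennreal \<bar>delta M 0 ?g (?V i) (X i)\<bar>)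
      \<le> ?C * (pmom_nn M (?V i) p * (pmom_nn M (X i) 2 + ennreal ((mean M (X i))\<^sup>2) - ?m)
        + ?m * (pmom_nn M (Xs i) (p + 1) + pmom_nn M (X i) (p + 1)))" .
  qed
  finally show ?thesis
    by (simp only: sum_distrib_left)
qed

end

theorem proposition4p2:
  fixes M :: "'a measure" and n N :: nat and p :: real and h :: "nat \<Rightarrow> real"
    and X Xs :: "nat \<Rightarrow> 'a \<Rightarrow> nat"
  assumes "prob_space M"
    and "n \<ge> 1"
    and "p \<ge> 0"
    and "h \<in> O(\<lambda>x. npow x p)"
    and "prob_space.indep_vars M (\<lambda>_. count_space UNIV) X {1..n}"
    and "\<And>i. i \<in> {1..n} \<Longrightarrow> integrable M (\<lambda>\<omega>. npow (X i \<omega>) (real N + p + 1))"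
    and "\<And>i. i \<in> {1..n} \<Longrightarrow> mean M (X i) > 0"
    and "\<And>i. i \<in> {1..n} \<Longrightarrow> poisson_zero_biased M (X i) (Xs i)"
    and "\<And>i. i \<in> {1..n} \<Longrightarrow>
           prob_space.indep_var M (count_space UNIV) (total_without n X i) (count_space UNIV) (Xs i)"
  shows "(N = 0 \<longrightarrow>
            ennreal \<bar>stein_rem M n X Xs 0 h\<bar> \<le>
              ennreal (max (2 powr (p - 1)) 1) * diff_norm 0 p (stein_sol (total_mean M n X) h) *
              (\<Sum>i=1..n.
                 pmom_nn M (total_without n X i) p *
                   (pmom_nn M (X i) 2 + ennreal ((mean M (X i))\<^sup>2) - ennreal (mean M (X i)))
                 + ennreal (mean M (X i)) * (pmom_nn M (Xs i) (p + 1) + pmom_nn M (X i) (p + 1))))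
       \<and>
         (N \<ge> 1 \<longrightarrow>
            ennreal \<bar>stein_rem M n X Xs N h\<bar> \<le>
              (\<Sum>i=1..n. ennreal (mean M (X i)) *
                ((\<Sum>d=1..N. \<Sum>J\<in>multi_idx d N.
                    mom_idx_nn M (X i) (butlast J) *
                    (mom_nn M (Xs i) (last J) + mom_nn M (X i) (last J)) *
                    ennreal \<bar>stein_rem M n X Xs (N - sum_list J)
                      ((fdiff ^^ sum_list J) (stein_shift M n X h))\<bar>)
                 + ennreal (max (2 powr (p - 1)) 1) * diff_norm N p (stein_sol (total_mean M n X) h) *
                   (\<Sum>k=0..N. mom_nn M (Xs i) k *
                     (\<Sum>d=0..N - k. \<Sum>J\<in>multi_idx d (N - k).
                        mom_idx_nn M (X i) J *
                        (pmom_nn M (total_without n X i) p * mom_nn M (X i) (N - k - sum_list J + 1)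
                         + mom_pow_nn M (X i) (N - k - sum_list J + 1) p)))
                 + ennreal (max (2 powr (p - 1)) 1) * diff_norm N p (stein_sol (total_mean M n X) h) *
                   (pmom_nn M (total_without n X i) p * mom_nn M (Xs i) (N + 1)
                    + mom_pow_nn M (Xs i) (N + 1) p))))"
proof -
  interpret prob_space M by fact
  have X: "indep_var (count_space UNIV) (total_without n X i) (count_space UNIV) (X i)"
    if "i \<in> {1..n}" for i
    using assms(5) that by (rule indep_var_total_without)
  show ?thesis
  proof (intro conjI impI)
    assume "N = 0"
    then show "ennreal \<bar>stein_rem M n X Xs 0 h\<bar> \<le>
        ennreal (max (2 powr (p - 1)) 1) * diff_norm 0 p (stein_sol (total_mean M n X) h) *
        (\<Sum>i=1..n.
           pmom_nn M (total_without n X i) p *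
             (pmom_nn M (X i) 2 + ennreal ((mean M (X i))\<^sup>2) - ennreal (mean M (X i)))
           + ennreal (mean M (X i)) * (pmom_nn M (Xs i) (p + 1) + pmom_nn M (X i) (p + 1)))"
      \<comment> \<open>At N = 0 the moment assumption has order p + 1, which is what the
        integrability of \<open>W * f W\<close> requires.\<close>
      using assms(6) by (intro stein_rem_0_le[OF assms(2-4) X _ assms(7-9)]) simp_all
  next
    assume "1 \<le> N"
    from stein_rem_recursive_le[OF assms(3) this X assms(9) refl]
    show "ennreal \<bar>stein_rem M n X Xs N h\<bar> \<le>
              (\<Sum>i=1..n. ennreal (mean M (X i)) *
                ((\<Sum>d=1..N. \<Sum>J\<in>multi_idx d N.
                    mom_idx_nn M (X i) (butlast J) *
                    (mom_nn M (Xs i) (last J) + mom_nn M (X i) (last J)) *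
                    ennreal \<bar>stein_rem M n X Xs (N - sum_list J)
                      ((fdiff ^^ sum_list J) (stein_shift M n X h))\<bar>)
                 + ennreal (max (2 powr (p - 1)) 1) * diff_norm N p (stein_sol (total_mean M n X) h) *
                   (\<Sum>k=0..N. mom_nn M (Xs i) k *
                     (\<Sum>d=0..N - k. \<Sum>J\<in>multi_idx d (N - k).
                        mom_idx_nn M (X i) J *
                        (pmom_nn M (total_without n X i) p * mom_nn M (X i) (N - k - sum_list J + 1)
                         + mom_pow_nn M (X i) (N - k - sum_list J + 1) p)))
                 + ennreal (max (2 powr (p - 1)) 1) * diff_norm N p (stein_sol (total_mean M n X) h) *
                   (pmom_nn M (total_without n X i) p * mom_nn M (Xs i) (N + 1)
                    + mom_pow_nn M (Xs i) (N + 1) p)))" .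
  qed
qed

end
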